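(* Let $n\ge 0$ and let $\psi : \mathbf{V}(2n+1)\to K_0(\operatorname{mod}\mathsf{Y}_n)$ be the isomorphism of abelian groups defined by $\psi(Q_x)=P_x$ for every planar binary tree $x\in\mathsf{Y}_n$. Then $\psi$ transforms the anticyclic operator $\theta_{\mathbf{V}}$ of $\mathbf{V}(2n+1)$ into the Coxeter transformation $\theta$ of the Tamari poset $\mathsf{Y}_n$: $$\psi\,\theta_{\mathbf{V}}=\theta\,\psi .$$
   Context: Operads. One works with graded abelian groups and the Koszul sign rule; morphisms are linear maps preserving the grading. A (nonsymmetric) operad $\mathbf{P}$ is a collection of graded abelian groups $\mathbf{P}(n)=\bigoplus_{k\in\mathbb{Z}}\mathbf{P}(n)_k$, $n\ge 1$, with a unit $\boldsymbol{1}\in\mathbf{P}(1)_0$ (neutral for all compositions) and weight-additive linear maps $\circ_i:\mathbf{P}(m)\otimes\mathbf{P}(n)\to\mathbf{P}(m+n-1)$, $1\le i\le m$, satisfying $(a\circ_i b)\circ_{j+i-1}c=a\circ_i(b\circ_j c)$ and, for $i<j$, $(a\circ_i b)\circ_{j+\#b-1}c=(-1)^{bc}(a\circ_j c)\circ_i b$. For $a\in\mathbf{P}(n)_k$, $\#a=n$ is the degree and $k$ the weight; in exponents of $-1$ the letter $a$ denotes the weight of $a$. Write $a\circ_{\max}b=a\circ_{\#a}b$. An anticyclic structure on $\mathbf{P}$ is a (weight-preserving) linear operator $\theta$ on each $\mathbf{P}(n)$ with $\theta(\boldsymbol{1})=-\boldsymbol{1}$, $\theta^{n+1}=\mathrm{Id}$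 on $\mathbf{P}(n)$, $\theta(a\circ_i b)=\theta(a)\circ_{i-1}b$ for $i>1$, and $\theta(a\circ_1 b)=-(-1)^{ab}\theta(b)\circ_{\max}\theta(a)$. The operad $\mathbf{V}$ is presented by one generator $g$ of degree $3$ and weight $1$ with the single relation $g\circ_1 g-g\circ_2 g+g\circ_3 g=0$. The operators $\theta_{\mathbf{V}}$ are those of the unique anticyclic structure on $\mathbf{V}$ with $\theta_{\mathbf{V}}(g)=-g$. Trees. $\mathsf{Y}_n$ is the set of planar binary trees with $n$ internal (trivalent) vertices ($n+1$ leaves, one root). Such a tree is either the trivial tree $|$ ($n=0$) or decomposes uniquely as a pair $(x,y)$ of planar binary trees (left and right subtrees at the root vertex). Define $Q_x\in\mathbf{V}(2n+1)_n$ for $x\in\mathsf{Y}_n$ by $Q_{|}=\boldsymbol{1}$ and, for $z=(x,y)$, $Q_z=(-1)^{Q_x}(g\circ_1Q_x)\circ_{\max}Q_y$. The family $(Q_x)_{x\in\mathsf{Y}_n}$ is a basis of $\mathbf{V}(2n+1)$. Tamari order. On $\mathsf{Y}_n$, $x\le y$ if one can pass from $y$ to $x$ by a (possibly empty) sequence of local moves replacing a subtree of the form $(A,(B,C))$ (right edge) by $((A,B),C)$ (left edge). Modules. Fix a field $\mathsf{k}$. $\operatorname{mod}\mathsf{Y}_n$ is the category of (finite-dimensional) modules over the Hasse diagram of $\mathsf{Y}_n$ viewed as a quiver with edges oriented from the maximum to the minimum, with relations identifying any two paths having the same start and end (equivalently modules over the incidence algebra of $\mathsf{Y}_n$). $K_0(\operatorname{mod}\mathsf{Y}_n)$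 is its Grothendieck group, free abelian with three bases indexed by $x\in\mathsf{Y}_n$: classes of simples $S_x$, of indecomposable projectives $P_x=\sum_{y\le x}S_y$, and of indecomposable injectives $I_x=\sum_{y\ge x}S_y$. The Coxeter transformation $\theta$ is the endomorphism of $K_0(\operatorname{mod}\mathsf{Y}_n)$ with $\theta(P_x)=-I_x$ for all $x\in\mathsf{Y}_n$. *)

theory Defs
  imports "HOL-Algebra.Free_Abelian_Groups" "Jordan_Normal_Form.Matrix_Kernel"
begin

section \<open>Graded nonsymmetric operads and anticyclic structures\<close>

text \<open>
  Abelian groups are written multiplicatively, as in \<open>HOL-Algebra\<close>: the sum, zero and
  opposite of the mathematics are \<open>\<otimes>\<close>, \<open>\<one>\<close> and \<open>inv\<close>, and a sign acts as an integer power.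
  \<open>op_wt P n k\<close> is the weight \<open>k\<close> part of the group \<open>op_grp P n\<close> in degree \<open>n\<close>, and
  \<open>op_comp P m n i a b\<close> is the composition of \<open>a\<close> (degree \<open>m\<close>) and \<open>b\<close> (degree \<open>n\<close>) at place \<open>i\<close>.
  Only degrees \<open>n \<ge> 1\<close> matter.
\<close>

record 'a operad_data =
  op_grp :: "nat \<Rightarrow> 'a monoid"
  op_wt :: "nat \<Rightarrow> int \<Rightarrow> 'a set"
  op_unit :: 'a
  op_comp :: "nat \<Rightarrow> nat \<Rightarrow> nat \<Rightarrow> 'a \<Rightarrow> 'a \<Rightarrow> 'a"

definition ksgn :: "int \<Rightarrow> int" where
  "ksgn k = (if even k then 1 else - 1)"

locale operad =
  fixes P :: "'a operad_data"
  assumes grp: "n \<ge> 1 \<Longrightarrow> comm_group (op_grp P n)"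
    and wt_subgroup: "n \<ge> 1 \<Longrightarrow> subgroup (op_wt P n k) (op_grp P n)"
    and direct_sum: "\<lbrakk>n \<ge> 1; x \<in> carrier (op_grp P n)\<rbrakk> \<Longrightarrow>
      \<exists>!c. (\<forall>k. c k \<in> op_wt P n k) \<and> finite {k. c k \<noteq> \<one>\<^bsub>op_grp P n\<^esub>} \<and>
           x = gfinprod (op_grp P n) c UNIV"
    and unit_wt: "op_unit P \<in> op_wt P 1 0"
    and comp_hom_left: "\<lbrakk>m \<ge> 1; n \<ge> 1; 1 \<le> i; i \<le> m; b \<in> carrier (op_grp P n)\<rbrakk> \<Longrightarrow>
      (\<lambda>a. op_comp P m n i a b) \<in> hom (op_grp P m) (op_grp P (m + n - 1))"
    and comp_hom_right: "\<lbrakk>m \<ge> 1; n \<ge> 1; 1 \<le> i; i \<le> m; a \<in> carrier (op_grp P m)\<rbrakk> \<Longrightarrow>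
      op_comp P m n i a \<in> hom (op_grp P n) (op_grp P (m + n - 1))"
    and comp_wt: "\<lbrakk>m \<ge> 1; n \<ge> 1; 1 \<le> i; i \<le> m; a \<in> op_wt P m k; b \<in> op_wt P n l\<rbrakk> \<Longrightarrow>
      op_comp P m n i a b \<in> op_wt P (m + n - 1) (k + l)"
    and unit_left: "\<lbrakk>n \<ge> 1; b \<in> carrier (op_grp P n)\<rbrakk> \<Longrightarrow> op_comp P 1 n 1 (op_unit P) b = b"
    and unit_right: "\<lbrakk>m \<ge> 1; 1 \<le> i; i \<le> m; a \<in> carrier (op_grp P m)\<rbrakk> \<Longrightarrow>
      op_comp P m 1 i a (op_unit P) = a"
    and comp_assoc: "\<lbrakk>m \<ge> 1; n \<ge> 1; r \<ge> 1; 1 \<le> i; i \<le> m; 1 \<le> j; j \<le> n;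
        a \<in> carrier (op_grp P m); b \<in> carrier (op_grp P n); c \<in> carrier (op_grp P r)\<rbrakk> \<Longrightarrow>
      op_comp P (m + n - 1) r (j + i - 1) (op_comp P m n i a b) c =
      op_comp P m (n + r - 1) i a (op_comp P n r j b c)"
    and comp_commute: "\<lbrakk>m \<ge> 1; n \<ge> 1; r \<ge> 1; 1 \<le> i; i < j; j \<le> m;
        a \<in> op_wt P m p; b \<in> op_wt P n q; c \<in> op_wt P r s\<rbrakk> \<Longrightarrow>
      op_comp P (m + n - 1) r (j + n - 1) (op_comp P m n i a b) c =
      op_comp P (m + r - 1) n i (op_comp P m r j a c) b [^]\<^bsub>op_grp P (m + n + r - 2)\<^esub> ksgn (q * s)"

locale anticyclic_operad = operad P for P :: "'a operad_data" +
  fixes \<theta> :: "nat \<Rightarrow> 'a \<Rightarrow> 'a"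
  assumes theta_hom: "n \<ge> 1 \<Longrightarrow> \<theta> n \<in> hom (op_grp P n) (op_grp P n)"
    and theta_wt: "\<lbrakk>n \<ge> 1; a \<in> op_wt P n k\<rbrakk> \<Longrightarrow> \<theta> n a \<in> op_wt P n k"
    and theta_unit: "\<theta> 1 (op_unit P) = inv\<^bsub>op_grp P 1\<^esub> op_unit P"
    and theta_cyclic: "\<lbrakk>n \<ge> 1; a \<in> carrier (op_grp P n)\<rbrakk> \<Longrightarrow> (\<theta> n ^^ (n + 1)) a = a"
    and theta_comp: "\<lbrakk>m \<ge> 1; n \<ge> 1; 1 < i; i \<le> m;
        a \<in> carrier (op_grp P m); b \<in> carrier (op_grp P n)\<rbrakk> \<Longrightarrow>
      \<theta> (m + n - 1) (op_comp P m n i a b) = op_comp P m n (i - 1) (\<theta> m a) b"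
    and theta_comp_1: "\<lbrakk>m \<ge> 1; n \<ge> 1; a \<in> op_wt P m k; b \<in> op_wt P n l\<rbrakk> \<Longrightarrow>
      \<theta> (m + n - 1) (op_comp P m n 1 a b) =
      op_comp P n m n (\<theta> n b) (\<theta> m a) [^]\<^bsub>op_grp P (m + n - 1)\<^esub> (- ksgn (k * l))"


section \<open>The operad \<open>V\<close>\<close>

text \<open>
  The operad presented by a generator \<open>g\<close> and a relation is constructed as follows: formal iterated
  compositions of \<open>g\<close> and the unit span free abelian groups, which are divided by the smallest family of
  subgroups that is stable under composition on both sides and contains the operad axioms
  and the given relation.
\<close>

datatype opmono = MUnit | MGen | MComp opmono nat opmono

fun mdeg :: "opmono \<Rightarrow> nat" where
  "mdeg MUnit = 1"
| "mdeg MGen = 3"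
| "mdeg (MComp s i t) = mdeg s + mdeg t - 1"

fun mwt :: "opmono \<Rightarrow> int" where
  "mwt MUnit = 0"
| "mwt MGen = 1"
| "mwt (MComp s i t) = mwt s + mwt t"

fun mvalid :: "opmono \<Rightarrow> bool" where
  "mvalid MUnit = True"
| "mvalid MGen = True"
| "mvalid (MComp s i t) = (mvalid s \<and> mvalid t \<and> 1 \<le> i \<and> i \<le> mdeg s)"

definition opmonos :: "nat \<Rightarrow> opmono set" where
  "opmonos n = {t. mvalid t \<and> mdeg t = n}"

abbreviation mfree :: "nat \<Rightarrow> (opmono \<Rightarrow>\<^sub>0 int) monoid" where
  "mfree n \<equiv> free_Abelian_group (opmonos n)"

definition mcomp :: "nat \<Rightarrow> (opmono \<Rightarrow>\<^sub>0 int) \<Rightarrow> (opmono \<Rightarrow>\<^sub>0 int) \<Rightarrow> (opmono \<Rightarrow>\<^sub>0 int)" where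
  "mcomp i a b = frag_extend (\<lambda>s. frag_extend (\<lambda>t. frag_of (MComp s i t)) b) a"

inductive vrel :: "nat \<Rightarrow> (opmono \<Rightarrow>\<^sub>0 int) \<Rightarrow> bool" where
  zero: "vrel n 0"
| diff: "vrel n a \<Longrightarrow> vrel n b \<Longrightarrow> vrel n (a - b)"
| comp_left: "vrel m a \<Longrightarrow> mvalid t \<Longrightarrow> 1 \<le> i \<Longrightarrow> i \<le> m \<Longrightarrow>
    vrel (m + mdeg t - 1) (mcomp i a (frag_of t))"
| comp_right: "vrel n b \<Longrightarrow> mvalid s \<Longrightarrow> 1 \<le> i \<Longrightarrow> i \<le> mdeg s \<Longrightarrow>
    vrel (mdeg s + n - 1) (mcomp i (frag_of s) b)"
| unit_left: "mvalid t \<Longrightarrow> vrel (mdeg t) (frag_of (MComp MUnit 1 t) - frag_of t)"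
| unit_right: "mvalid s \<Longrightarrow> 1 \<le> i \<Longrightarrow> i \<le> mdeg s \<Longrightarrow>
    vrel (mdeg s) (frag_of (MComp s i MUnit) - frag_of s)"
| assoc: "mvalid s \<Longrightarrow> mvalid t \<Longrightarrow> mvalid u \<Longrightarrow> 1 \<le> i \<Longrightarrow> i \<le> mdeg s \<Longrightarrow> 1 \<le> j \<Longrightarrow> j \<le> mdeg t \<Longrightarrow>
    vrel (mdeg s + mdeg t + mdeg u - 2)
      (frag_of (MComp (MComp s i t) (j + i - 1) u) - frag_of (MComp s i (MComp t j u)))"
| commute: "mvalid s \<Longrightarrow> mvalid t \<Longrightarrow> mvalid u \<Longrightarrow> 1 \<le> i \<Longrightarrow> i < j \<Longrightarrow> j \<le> mdeg s \<Longrightarrow>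
    vrel (mdeg s + mdeg t + mdeg u - 2)
      (frag_of (MComp (MComp s i t) (j + mdeg t - 1) u)
        - frag_cmul (ksgn (mwt t * mwt u)) (frag_of (MComp (MComp s j u) i t)))"
| relation: "vrel 5 (frag_of (MComp MGen 1 MGen) - frag_of (MComp MGen 2 MGen)
                      + frag_of (MComp MGen 3 MGen))"

type_synonym velem = "(opmono \<Rightarrow>\<^sub>0 int) set"

definition vcls :: "nat \<Rightarrow> (opmono \<Rightarrow>\<^sub>0 int) \<Rightarrow> velem" where
  "vcls n x = Collect (vrel n) #>\<^bsub>mfree n\<^esub> x"

definition V_operad :: "velem operad_data" where
  "V_operad = \<lparr>
     op_grp = (\<lambda>n. mfree n Mod Collect (vrel n)),
     op_wt = (\<lambda>n k. vcls n ` {x. Poly_Mapping.keys x \<subseteq> {t \<in> opmonos n. mwt t = k}}),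
     op_unit = vcls 1 (frag_of MUnit),
     op_comp = (\<lambda>m n i A B. \<Union>a\<in>A. \<Union>b\<in>B. vcls (m + n - 1) (mcomp i a b)) \<rparr>"

definition V_gen :: velem where
  "V_gen = vcls 3 (frag_of MGen)"


lemma mdeg_pos: "mvalid t \<Longrightarrow> 1 \<le> mdeg t"
  by (induction t) auto

lemma mdeg_mwt: "mvalid t \<Longrightarrow> int (mdeg t) = 2 * mwt t + 1"
proof (induction t)
  case (MComp s i t)
  then show ?case using mdeg_pos[of s] mdeg_pos[of t] by (auto simp: of_nat_diff)
qed auto

lemma mcomp_add:
  "mcomp i (a + a') b = mcomp i a b + mcomp i a' b"
  "mcomp i a (b + b') = mcomp i a b + mcomp i a b'"
  unfolding mcomp_def
  by (simp_all add: frag_extend_add) (simp add: frag_extend_def frag_cmul_distrib2 sum.distrib)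

lemma mcomp_simps:
  "mcomp i 0 b = 0" "mcomp i a 0 = 0"
  "mcomp i (a - a') b = mcomp i a b - mcomp i a' b"
  "mcomp i a (b - b') = mcomp i a b - mcomp i a b'"
  "mcomp i (a + a') b = mcomp i a b + mcomp i a' b"
  "mcomp i a (b + b') = mcomp i a b + mcomp i a b'"
  "mcomp i (frag_of s) (frag_of t) = frag_of (MComp s i t)"
  using mcomp_add(2)[of i a "b - b'" b'] mcomp_add(1)[of i "a - a'" a' b]
  by (simp_all add: mcomp_add algebra_simps) (simp_all add: mcomp_def frag_extend_eq_0)

lemma mcomp_keys:
  assumes "z \<in> Poly_Mapping.keys (mcomp i a b)"
  obtains s t where "z = MComp s i t" "s \<in> Poly_Mapping.keys a" "t \<in> Poly_Mapping.keys b"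
proof -
  obtain s where s: "s \<in> Poly_Mapping.keys a"
    and "z \<in> Poly_Mapping.keys (frag_extend (\<lambda>t. frag_of (MComp s i t)) b)"
    using subsetD[OF keys_frag_extend assms[unfolded mcomp_def]] by (rule UN_E)
  from subsetD[OF keys_frag_extend this(2)] obtain t
    where "t \<in> Poly_Mapping.keys b" "z \<in> Poly_Mapping.keys (frag_of (MComp s i t))"
    by (rule UN_E)
  with s that show thesis by auto
qed

lemma mcomp_mfree:
  assumes "Poly_Mapping.keys a \<subseteq> opmonos m" "Poly_Mapping.keys b \<subseteq> opmonos n" "1 \<le> i" "i \<le> m"
  shows "Poly_Mapping.keys (mcomp i a b) \<subseteq> opmonos (m + n - 1)"
proof
  fix z assume "z \<in> Poly_Mapping.keys (mcomp i a b)"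
  then obtain s t where "z = MComp s i t" "s \<in> Poly_Mapping.keys a" "t \<in> Poly_Mapping.keys b"
    by (rule mcomp_keys)
  with subsetD[OF assms(1), of s] subsetD[OF assms(2), of t] show "z \<in> opmonos (m + n - 1)" using assms(3,4) by (simp add: opmonos_def)
qed

lemma mcomp_wt_mfree:
  assumes "Poly_Mapping.keys a \<subseteq> {t \<in> opmonos m. mwt t = k}"
    "Poly_Mapping.keys b \<subseteq> {t \<in> opmonos n. mwt t = l}" "1 \<le> i" "i \<le> m"
  shows "Poly_Mapping.keys (mcomp i a b) \<subseteq> {t \<in> opmonos (m + n - 1). mwt t = k + l}"
proof
  fix z assume "z \<in> Poly_Mapping.keys (mcomp i a b)"
  then obtain s t where "z = MComp s i t" "s \<in> Poly_Mapping.keys a" "t \<in> Poly_Mapping.keys b"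
    by (rule mcomp_keys)
  with subsetD[OF assms(1), of s] subsetD[OF assms(2), of t] show "z \<in> {t \<in> opmonos (m + n - 1). mwt t = k + l}"
    using assms(3,4) by (simp add: opmonos_def)
qed

lemma keys_diffI:
  fixes a b :: "'a \<Rightarrow>\<^sub>0 int"
  assumes "Poly_Mapping.keys a \<subseteq> S" "Poly_Mapping.keys b \<subseteq> S"
  shows "Poly_Mapping.keys (a - b) \<subseteq> S"
  by (rule order.trans[OF keys_diff Un_least[OF assms]])

lemma keys_addI:
  fixes a b :: "'a \<Rightarrow>\<^sub>0 int"
  assumes "Poly_Mapping.keys a \<subseteq> S" "Poly_Mapping.keys b \<subseteq> S"
  shows "Poly_Mapping.keys (a + b) \<subseteq> S"
  by (rule order.trans[OF keys_add Un_least[OF assms]])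

lemma vrel_keys: "vrel n x \<Longrightarrow> Poly_Mapping.keys x \<subseteq> opmonos n"
proof (induction rule: vrel.induct)
  case (diff n a b) then show ?case by (intro keys_diffI)
next
  case (comp_left m a t i) then show ?case
    by (intro mcomp_mfree) (auto simp: opmonos_def)
next
  case (comp_right n b s i) then show ?case
    by (intro mcomp_mfree) (auto simp: opmonos_def)
next
  case (unit_left t) then show ?case
    by (intro keys_diffI) (auto simp: opmonos_def)
next
  case (unit_right s i) then show ?case
    by (intro keys_diffI) (auto simp: opmonos_def)
next
  case (assoc s t u i j) then show ?case
    using mdeg_pos[of s] mdeg_pos[of t] mdeg_pos[of u]
    by (intro keys_diffI) (auto simp: opmonos_def)
next
  case (commute s t u i j) then show ?case
    using mdeg_pos[of s] mdeg_pos[of t] mdeg_pos[of u]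
    by (intro keys_diffI order.trans[OF keys_cmul]) (auto simp: opmonos_def)
next
  case relation show ?case
    by (intro keys_diffI keys_addI) (auto simp: opmonos_def)
qed auto

lemma vrel_minus: "vrel n a \<Longrightarrow> vrel n (- a)"
  using vrel.diff[OF vrel.zero] by fastforce

lemma vrel_add: "vrel n a \<Longrightarrow> vrel n b \<Longrightarrow> vrel n (a + b)"
  using vrel.diff[OF _ vrel_minus, of n a b] by simp

lemma vrel_subgroup: "subgroup (Collect (vrel n)) (mfree n)"
  by unfold_locales
     (auto dest: vrel_keys intro: vrel_add vrel.zero simp: vrel_minus vrel_keys)

lemma vrel_normal: "Collect (vrel n) \<lhd> mfree n"
  by (rule comm_group.subgroup_imp_normal[OF abelian_free_Abelian_group vrel_subgroup])

lemma op_grp_V: "op_grp V_operad n = mfree n Mod Collect (vrel n)"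
  by (simp add: V_operad_def)

lemma comm_group_V: "comm_group (op_grp V_operad n)"
  unfolding op_grp_V
  by (rule comm_group.abelian_FactGroup[OF abelian_free_Abelian_group vrel_subgroup])

lemma carrier_V: "carrier (op_grp V_operad n) = vcls n ` carrier (mfree n)"
  by (simp add: op_grp_V carrier_FactGroup vcls_def)

lemma vcls_eq_iff: "vcls n x = vcls n y \<longleftrightarrow> vrel n (x - y)"
proof -
  have "vcls n x = (\<lambda>h. h + x) ` Collect (vrel n)" for x
    by (auto simp: vcls_def r_coset_def)
  note e = this
  show ?thesis
  proof
    assume "vcls n x = vcls n y"
    moreover have "0 + x \<in> vcls n x" unfolding e using vrel.zero by blast
    ultimately obtain h where "vrel n h" "x = h + y" by (auto simp: e)
    then show "vrel n (x - y)" by simp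
  next
    assume r: "vrel n (x - y)"
    have "\<exists>h'. vrel n h' \<and> h + x = h' + y" if "vrel n h" for h
      using vrel_add[OF that r] by (intro exI[of _ "h + (x - y)"]) simp
    moreover have "\<exists>h'. vrel n h' \<and> h + y = h' + x" if "vrel n h" for h
      using vrel.diff[OF that r] by (intro exI[of _ "h - (x - y)"]) simp
    ultimately show "vcls n x = vcls n y" unfolding e by auto
  qed
qed

lemma vcls_mem:
  assumes "z \<in> vcls n x" shows "vrel n (z - x)"
  using assms by (auto simp: vcls_def r_coset_def)

lemma vcls_self: "x \<in> vcls n x"
  using vrel.zero[of n] by (force simp: vcls_def r_coset_def)

lemma vcls_add:
  assumes "Poly_Mapping.keys x \<subseteq> opmonos n" "Poly_Mapping.keys y \<subseteq> opmonos n"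
  shows "vcls n x \<otimes>\<^bsub>op_grp V_operad n\<^esub> vcls n y = vcls n (x + y)"
  using normal.rcos_sum[OF vrel_normal, of x n y] assms
  by (simp add: op_grp_V vcls_def)

lemma vcls_one: "\<one>\<^bsub>op_grp V_operad n\<^esub> = vcls n 0"
  by (auto simp: op_grp_V vcls_def r_coset_def)

lemma vcls_int_pow:
  assumes "Poly_Mapping.keys x \<subseteq> opmonos n"
  shows "vcls n x [^]\<^bsub>op_grp V_operad n\<^esub> (k::int) = vcls n (frag_cmul k x)"
  using normal.FactGroup_int_pow[OF vrel_normal, of x n k] assms
  by (simp add: op_grp_V vcls_def)

lemma frag_induct [consumes 1, case_names zero diff single]:
  assumes "Poly_Mapping.keys x \<subseteq> S" "R 0" "\<And>x y. R x \<Longrightarrow> R y \<Longrightarrow> R (x - y)"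
    "\<And>t. t \<in> S \<Longrightarrow> R (frag_of t)"
  shows "R x"
  using assms by (rule free_Abelian_group_induct)

lemma vrel_mcomp_left:
  assumes "vrel m a" "Poly_Mapping.keys b \<subseteq> opmonos n" "1 \<le> i" "i \<le> m"
  shows "vrel (m + n - 1) (mcomp i a b)"
  using assms(2)
proof (induction b rule: frag_induct)
  case (single t) then show ?case
    using vrel.comp_left[OF assms(1), of t i] assms by (auto simp: opmonos_def)
qed (auto simp: mcomp_simps intro: vrel.intros(1,2))

lemma vrel_mcomp_right:
  assumes "vrel n b" "Poly_Mapping.keys a \<subseteq> opmonos m" "1 \<le> i" "i \<le> m"
  shows "vrel (m + n - 1) (mcomp i a b)"
  using assms(2)
proof (induction a rule: frag_induct)
  case (single s) then show ?case
    using vrel.comp_right[OF assms(1), of s i] assms by (auto simp: opmonos_def)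
qed (auto simp: mcomp_simps intro: vrel.intros(1,2))

lemma op_comp_vcls:
  assumes a: "Poly_Mapping.keys a \<subseteq> opmonos m" and b: "Poly_Mapping.keys b \<subseteq> opmonos n"
    and i: "1 \<le> i" "i \<le> m"
  shows "op_comp V_operad m n i (vcls m a) (vcls n b) = vcls (m + n - 1) (mcomp i a b)"
proof -
  have "vcls (m + n - 1) (mcomp i a' b') = vcls (m + n - 1) (mcomp i a b)"
    if "a' \<in> vcls m a" "b' \<in> vcls n b" for a' b'
  proof -
    have ra: "vrel m (a' - a)" and rb: "vrel n (b' - b)"
      using that vcls_mem by auto
    have "Poly_Mapping.keys (a' - a + a) \<subseteq> opmonos m" by (rule keys_addI[OF vrel_keys[OF ra] a])
    moreover have "Poly_Mapping.keys (b' - b + b) \<subseteq> opmonos n" by (rule keys_addI[OF vrel_keys[OF rb] b])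
    ultimately have a': "Poly_Mapping.keys a' \<subseteq> opmonos m" and b': "Poly_Mapping.keys b' \<subseteq> opmonos n"
      by simp_all
    have "vrel (m + n - 1) (mcomp i (a' - a) b' + mcomp i a (b' - b))"
      by (intro vrel_add vrel_mcomp_left vrel_mcomp_right ra rb a b' i)
    then show ?thesis
      by (simp add: vcls_eq_iff mcomp_simps)
  qed
  then have "(\<Union>a'\<in>vcls m a. \<Union>b'\<in>vcls n b. vcls (m + n - 1) (mcomp i a' b')) =
      (\<Union>a'\<in>vcls m a. \<Union>b'\<in>vcls n b. vcls (m + n - 1) (mcomp i a b))"
    by simp
  also have "\<dots> = vcls (m + n - 1) (mcomp i a b)"
    using vcls_self[of a m] vcls_self[of b n] by auto
  finally show ?thesis by (simp add: V_operad_def)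
qed

lemma keys_mono: "Poly_Mapping.keys x \<subseteq> {t \<in> S. R t} \<Longrightarrow> Poly_Mapping.keys x \<subseteq> S"
  by auto

lemma op_wt_V: "op_wt V_operad n k =
    (if int n = 2 * k + 1 then carrier (op_grp V_operad n) else {\<one>\<^bsub>op_grp V_operad n\<^esub>})"
proof (cases "int n = 2 * k + 1")
  case True
  then have "{t \<in> opmonos n. mwt t = k} = opmonos n"
    using mdeg_mwt by (fastforce simp: opmonos_def)
  with True show ?thesis by (auto simp: V_operad_def carrier_FactGroup vcls_def)
next
  case False
  then have "{t \<in> opmonos n. mwt t = k} = {}"
    using mdeg_mwt by (fastforce simp: opmonos_def)
  with False show ?thesis unfolding vcls_one by (simp add: V_operad_def del: Collect_empty_eq)
qed

lemma op_wt_VE: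
  assumes "x \<in> op_wt V_operad n k"
  obtains a where "x = vcls n a" "Poly_Mapping.keys a \<subseteq> {t \<in> opmonos n. mwt t = k}"
  using assms by (auto simp: V_operad_def)

lemma vrel_mcomp_assoc:
  assumes "Poly_Mapping.keys a \<subseteq> opmonos m" "Poly_Mapping.keys b \<subseteq> opmonos n" "Poly_Mapping.keys c \<subseteq> opmonos r"
    "1 \<le> i" "i \<le> m" "1 \<le> j" "j \<le> n"
  shows "vrel (m + n + r - 2) (mcomp (j + i - 1) (mcomp i a b) c - mcomp i a (mcomp j b c))"
    (is "?R a b c")
proof -
  have d: "vrel k (x - x' - (y - y'))" if "vrel k (x - y)" "vrel k (x' - y')" for k x x' y y'
    using vrel.diff[OF that] by (simp add: algebra_simps)
  have 1: "?R (frag_of s) (frag_of t) (frag_of u)"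
    if "s \<in> opmonos m" "t \<in> opmonos n" "u \<in> opmonos r" for s t u
    using vrel.assoc[of s t u i j] that assms by (auto simp: opmonos_def mcomp_simps)
  have 2: "?R (frag_of s) (frag_of t) c" if "s \<in> opmonos m" "t \<in> opmonos n" for s t
    using assms(3)
    by (induction c rule: frag_induct) (use 1 that in \<open>auto simp: mcomp_simps intro: d vrel.zero\<close>)
  have 3: "?R (frag_of s) b c" if "s \<in> opmonos m" for s
    using assms(2)
    by (induction b rule: frag_induct) (use 2 that in \<open>auto simp: mcomp_simps intro: d vrel.zero\<close>)
  show ?thesis
    using assms(1)
    by (induction a rule: frag_induct) (use 3 in \<open>auto simp: mcomp_simps intro: d vrel.zero\<close>)
qed

lemma vrel_mcomp_commute:
  assumes "Poly_Mapping.keys a \<subseteq> opmonos m"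
    "Poly_Mapping.keys b \<subseteq> {t \<in> opmonos n. mwt t = q}"
    "Poly_Mapping.keys c \<subseteq> {t \<in> opmonos r. mwt t = s}"
    "1 \<le> i" "i < j" "j \<le> m"
  shows "vrel (m + n + r - 2) (mcomp (j + n - 1) (mcomp i a b) c
           - frag_cmul (ksgn (q * s)) (mcomp i (mcomp j a c) b))"
    (is "?R a b c")
proof -
  have d: "vrel k (x - x' - (y - y'))" if "vrel k (x - y)" "vrel k (x' - y')" for k x x' y y'
    using vrel.diff[OF that] by (simp add: algebra_simps)
  have fd: "frag_cmul k (x - y) = frag_cmul k x - frag_cmul k y" for k and x y :: "opmono \<Rightarrow>\<^sub>0 int"
    using frag_cmul_distrib2[of k "x - y" y] by simp
  have 1: "?R (frag_of x) (frag_of t) (frag_of u)"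
    if "x \<in> opmonos m" "t \<in> {t \<in> opmonos n. mwt t = q}" "u \<in> {t \<in> opmonos r. mwt t = s}" for x t u
    using vrel.commute[of x t u i j] that assms by (auto simp: opmonos_def mcomp_simps)
  have 2: "?R (frag_of x) (frag_of t) c" if "x \<in> opmonos m" "t \<in> {t \<in> opmonos n. mwt t = q}" for x t
    using assms(3)
    by (induction c rule: frag_induct) (use 1 that in \<open>auto simp: mcomp_simps fd intro: d vrel.zero\<close>)
  have 3: "?R (frag_of x) b c" if "x \<in> opmonos m" for x
    using assms(2)
    by (induction b rule: frag_induct) (use 2 that in \<open>auto simp: mcomp_simps fd intro: d vrel.zero\<close>)
  show ?thesis
    using assms(1)
    by (induction a rule: frag_induct) (use 3 in \<open>auto simp: mcomp_simps fd intro: d vrel.zero\<close>)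
qed

lemma gfinprod_single:
  assumes "comm_group G" "\<And>k. c k \<in> carrier G" "\<And>k. k \<noteq> k0 \<Longrightarrow> c k = \<one>\<^bsub>G\<^esub>"
  shows "gfinprod G c UNIV = c k0"
proof -
  interpret G: comm_group G by fact
  have "gfinprod G c UNIV = gfinprod G c {k0}"
    by (rule G.gfinprod_mono_neutral_cong_right) (use assms in auto)
  also have "\<dots> = c k0"
    by (subst G.gfinprod_insert) (use assms in \<open>auto simp: gfinprod_def\<close>)
  finally show ?thesis .
qed

lemma direct_sum_V:
  assumes "x \<in> carrier (op_grp V_operad n)"
  shows "\<exists>!c. (\<forall>k. c k \<in> op_wt V_operad n k) \<and> finite {k. c k \<noteq> \<one>\<^bsub>op_grp V_operad n\<^esub>} \<and>
           x = gfinprod (op_grp V_operad n) c UNIV"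
proof -
  let ?G = "op_grp V_operad n"
  interpret G: comm_group ?G by (rule comm_group_V)
  have sub: "op_wt V_operad n k \<subseteq> carrier ?G" for k by (auto simp: op_wt_V)
  show ?thesis
  proof (cases "\<exists>k. int n = 2 * k + 1")
    case True
    then obtain k0 where k0: "int n = 2 * k0 + 1" by blast
    have ne: "op_wt V_operad n k = {\<one>\<^bsub>?G\<^esub>}" if "k \<noteq> k0" for k
      using that k0 by (auto simp: op_wt_V)
    have eq: "op_wt V_operad n k0 = carrier ?G" using k0 by (simp add: op_wt_V)
    show ?thesis
    proof (rule ex1I[of _ "\<lambda>k. if k = k0 then x else \<one>\<^bsub>?G\<^esub>"], goal_cases)
      case 1
      have "gfinprod ?G (\<lambda>k. if k = k0 then x else \<one>\<^bsub>?G\<^esub>) UNIV = x"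
        by (subst gfinprod_single[OF comm_group_V, of _ _ k0]) (use assms in auto)
      moreover have "finite {k. (if k = k0 then x else \<one>\<^bsub>?G\<^esub>) \<noteq> \<one>\<^bsub>?G\<^esub>}"
        by (rule finite_subset[of _ "{k0}"]) auto
      ultimately show ?case using assms eq ne by auto
    next
      case (2 c)
      then have c: "c k = \<one>\<^bsub>?G\<^esub>" if "k \<noteq> k0" for k using ne[OF that] by auto
      have "c k \<in> carrier ?G" for k using 2 sub[of k] by blast
      then have "gfinprod ?G c UNIV = c k0"
        by (rule gfinprod_single[OF comm_group_V _ c])
      then show ?case using 2 by (intro ext) (simp add: c)
    qed
  next
    case False
    then have w: "op_wt V_operad n k = {\<one>\<^bsub>?G\<^esub>}" for k by (auto simp: op_wt_V)
    have "opmonos n = {}" using False mdeg_mwt by (fastforce simp: opmonos_def)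
    then have x: "x = \<one>\<^bsub>?G\<^esub>" using assms by (auto simp: carrier_V vcls_one)
    show ?thesis
    proof (rule ex1I[of _ "\<lambda>k. \<one>\<^bsub>?G\<^esub>"], goal_cases)
      case 1 then show ?case by (simp add: w x gfinprod_def)
    qed (auto simp: w)
  qed
qed

lemma operad_V: "operad V_operad"
proof (rule operad.intro)
  show "comm_group (op_grp V_operad n)" for n by (rule comm_group_V)
next
  fix n :: nat and k
  interpret G: comm_group "op_grp V_operad n" by (rule comm_group_V)
  show "subgroup (op_wt V_operad n k) (op_grp V_operad n)"
    by (simp add: op_wt_V G.subgroup_self G.triv_subgroup)
next
  fix n x assume "x \<in> carrier (op_grp V_operad n)"
  then show "\<exists>!c. (\<forall>k. c k \<in> op_wt V_operad n k) \<and> finite {k. c k \<noteq> \<one>\<^bsub>op_grp V_operad n\<^esub>} \<and>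
           x = gfinprod (op_grp V_operad n) c UNIV" by (rule direct_sum_V)
next
  show "op_unit V_operad \<in> op_wt V_operad 1 0"
    by (simp add: op_wt_V carrier_V) (auto simp: V_operad_def opmonos_def)
next
  fix m n i :: nat and b
  assume "1 \<le> i" "i \<le> m" "b \<in> carrier (op_grp V_operad n)"
  then show "(\<lambda>a. op_comp V_operad m n i a b) \<in> hom (op_grp V_operad m) (op_grp V_operad (m + n - 1))"
    by (auto simp: hom_def carrier_V op_comp_vcls vcls_add mcomp_mfree mcomp_simps keys_addI
        simp del: One_nat_def intro!: imageI)
next
  fix m n i :: nat and a
  assume "1 \<le> i" "i \<le> m" "a \<in> carrier (op_grp V_operad m)"
  then show "op_comp V_operad m n i a \<in> hom (op_grp V_operad n) (op_grp V_operad (m + n - 1))"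
    by (auto simp: hom_def carrier_V op_comp_vcls vcls_add mcomp_mfree mcomp_simps keys_addI
        simp del: One_nat_def intro!: imageI)
next
  fix m n i :: nat and a b k l
  assume i: "1 \<le> i" "i \<le> m" and "a \<in> op_wt V_operad m k" "b \<in> op_wt V_operad n l"
  then obtain x y where *: "a = vcls m x" "b = vcls n y"
    "Poly_Mapping.keys x \<subseteq> {t \<in> opmonos m. mwt t = k}"
    "Poly_Mapping.keys y \<subseteq> {t \<in> opmonos n. mwt t = l}"
    by (auto elim!: op_wt_VE)
  have "op_comp V_operad m n i a b = vcls (m + n - 1) (mcomp i x y)"
    unfolding * using *(3,4) i by (intro op_comp_vcls) auto
  moreover have "vcls (m + n - 1) (mcomp i x y) \<in> op_wt V_operad (m + n - 1) (k + l)"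
    using mcomp_wt_mfree[OF *(3,4) i] by (auto simp: V_operad_def)
  ultimately show "op_comp V_operad m n i a b \<in> op_wt V_operad (m + n - 1) (k + l)" by simp
next
  fix n :: nat and b assume "b \<in> carrier (op_grp V_operad n)"
  then obtain y where y: "b = vcls n y" "Poly_Mapping.keys y \<subseteq> opmonos n" by (auto simp: carrier_V)
  have u: "Poly_Mapping.keys (frag_of MUnit) \<subseteq> opmonos 1" by (simp add: opmonos_def)
  have "vrel n (mcomp 1 (frag_of MUnit) y - y)"
    using y(2)
  proof (induction y rule: frag_induct)
    case (diff x y) then show ?case using vrel.diff[OF diff] by (simp add: mcomp_simps algebra_simps)
  qed (auto simp: mcomp_simps opmonos_def intro: vrel.zero vrel.unit_left simp del: One_nat_def)
  then have "vcls n (mcomp 1 (frag_of MUnit) y) = vcls n y"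
    by (simp add: vcls_eq_iff)
  then show "op_comp V_operad 1 n 1 (op_unit V_operad) b = b"
    using op_comp_vcls[OF u y(2), of 1] y by (simp add: V_operad_def)
next
  fix m i :: nat and a assume i: "1 \<le> i" "i \<le> m" and "a \<in> carrier (op_grp V_operad m)"
  then obtain x where x: "a = vcls m x" "Poly_Mapping.keys x \<subseteq> opmonos m" by (auto simp: carrier_V)
  have u: "Poly_Mapping.keys (frag_of MUnit) \<subseteq> opmonos 1" by (simp add: opmonos_def)
  have "vrel m (mcomp i x (frag_of MUnit) - x)"
    using x(2)
  proof (induction x rule: frag_induct)
    case (diff x y) then show ?case using vrel.diff[OF diff] by (simp add: mcomp_simps algebra_simps)
  next
    case (single s) then show ?case using i vrel.unit_right[of s i] by (auto simp: mcomp_simps opmonos_def)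
  qed (auto simp: mcomp_simps intro: vrel.zero)
  then have "vcls m (mcomp i x (frag_of MUnit)) = vcls m x"
    by (simp add: vcls_eq_iff)
  then show "op_comp V_operad m 1 i a (op_unit V_operad) = a"
    using op_comp_vcls[OF x(2) u i] x by (simp add: V_operad_def)
next
  fix m n r i j :: nat and a b c
  assume h: "m \<ge> 1" "n \<ge> 1" "r \<ge> 1" "1 \<le> i" "i \<le> m" "1 \<le> j" "j \<le> n"
    and "a \<in> carrier (op_grp V_operad m)" "b \<in> carrier (op_grp V_operad n)" "c \<in> carrier (op_grp V_operad r)"
  then obtain x y z where [simp]: "a = vcls m x" "b = vcls n y" "c = vcls r z"
    and k: "Poly_Mapping.keys x \<subseteq> opmonos m" "Poly_Mapping.keys y \<subseteq> opmonos n" "Poly_Mapping.keys z \<subseteq> opmonos r"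
    by (auto simp: carrier_V)
  have d: "m + n - 1 + r - 1 = m + n + r - 2" "m + (n + r - 1) - 1 = m + n + r - 2" using h by auto
  have ab: "Poly_Mapping.keys (mcomp i x y) \<subseteq> opmonos (m + n - 1)" by (intro mcomp_mfree k h)
  have bc: "Poly_Mapping.keys (mcomp j y z) \<subseteq> opmonos (n + r - 1)" by (intro mcomp_mfree k h)
  have p: "1 \<le> j + i - 1" "j + i - 1 \<le> m + n - 1" using h by auto
  show "op_comp V_operad (m + n - 1) r (j + i - 1) (op_comp V_operad m n i a b) c =
      op_comp V_operad m (n + r - 1) i a (op_comp V_operad n r j b c)"
    using vrel_mcomp_assoc[OF k h(4-7)]
    by (simp add: op_comp_vcls k h ab bc p d vcls_eq_iff del: One_nat_def)
next
  fix m n r i j :: nat and a b c p q s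
  assume h: "m \<ge> 1" "n \<ge> 1" "r \<ge> 1" "1 \<le> i" "i < j" "j \<le> m"
    and "a \<in> op_wt V_operad m p" "b \<in> op_wt V_operad n q" "c \<in> op_wt V_operad r s"
  then obtain x y z where [simp]: "a = vcls m x" "b = vcls n y" "c = vcls r z"
    and w: "Poly_Mapping.keys x \<subseteq> {t \<in> opmonos m. mwt t = p}" "Poly_Mapping.keys y \<subseteq> {t \<in> opmonos n. mwt t = q}"
       "Poly_Mapping.keys z \<subseteq> {t \<in> opmonos r. mwt t = s}"
    by (auto elim!: op_wt_VE)
  note k = w[THEN keys_mono]
  have d: "m + n - 1 + r - 1 = m + n + r - 2" "m + r - 1 + n - 1 = m + n + r - 2" using h by auto
  have h': "i \<le> m" "1 \<le> j" using h by auto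
  have ab: "Poly_Mapping.keys (mcomp i x y) \<subseteq> opmonos (m + n - 1)" by (intro mcomp_mfree k h h')
  have ac: "Poly_Mapping.keys (mcomp j x z) \<subseteq> opmonos (m + r - 1)" by (intro mcomp_mfree k h h')
  have p: "1 \<le> j + n - 1" "j + n - 1 \<le> m + n - 1" "i \<le> m + r - 1" using h by auto
  have l: "Poly_Mapping.keys (mcomp i (mcomp j x z) y) \<subseteq> opmonos (m + n + r - 2)"
    using mcomp_mfree[OF ac k(2) h(4) p(3)] d by simp
  show "op_comp V_operad (m + n - 1) r (j + n - 1) (op_comp V_operad m n i a b) c =
      op_comp V_operad (m + r - 1) n i (op_comp V_operad m r j a c) b [^]\<^bsub>op_grp V_operad (m + n + r - 2)\<^esub> ksgn (q * s)"
    using vrel_mcomp_commute[OF k(1) w(2,3) h(4-6)]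
    by (simp add: op_comp_vcls k h h' ab ac p d vcls_int_pow l vcls_eq_iff del: One_nat_def)
qed


section \<open>Planar binary trees and the Tamari order\<close>

datatype pbt = Leaf | Node pbt pbt

fun vertices :: "pbt \<Rightarrow> nat" where
  "vertices Leaf = 0"
| "vertices (Node x y) = vertices x + vertices y + 1"

definition Y :: "nat \<Rightarrow> pbt set" where
  "Y n = {x. vertices x = n}"

inductive rotation :: "pbt \<Rightarrow> pbt \<Rightarrow> bool" where
  root: "rotation (Node a (Node b c)) (Node (Node a b) c)"
| left: "rotation x x' \<Longrightarrow> rotation (Node x y) (Node x' y)"
| right: "rotation y y' \<Longrightarrow> rotation (Node x y) (Node x y')"

definition tamari_le :: "pbt \<Rightarrow> pbt \<Rightarrow> bool" where
  "tamari_le x y \<longleftrightarrow> rotation\<^sup>*\<^sup>* y x"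

fun Q :: "pbt \<Rightarrow> velem" where
  "Q Leaf = op_unit V_operad"
| "Q (Node x y) =
     (let p = 2 * vertices x + 1; q = 2 * vertices y + 1 in
      op_comp V_operad (p + 2) q (p + 2) (op_comp V_operad 3 p 1 V_gen (Q x)) (Q y)
        [^]\<^bsub>op_grp V_operad (p + q + 1)\<^esub> ksgn (int (vertices x)))"


section \<open>Modules over a finite poset and their Grothendieck group\<close>

text \<open>
  A finite-dimensional module over the Hasse diagram of a finite poset \<open>(X, leq)\<close> is given in
  coordinates: the space at \<open>x\<close> is \<open>k^(rdim M x)\<close>, and the arrow from \<open>y\<close> to \<open>x\<close> acts by the
  matrix \<open>rmap M y x\<close>. Every finite-dimensional module is isomorphic to one of this form.
\<close>

record ('v, 'k) qrep =
  rdim :: "'v \<Rightarrow> nat"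
  rmap :: "'v \<Rightarrow> 'v \<Rightarrow> 'k mat"

definition hasse_arrow :: "'v set \<Rightarrow> ('v \<Rightarrow> 'v \<Rightarrow> bool) \<Rightarrow> 'v \<Rightarrow> 'v \<Rightarrow> bool" where
  "hasse_arrow X leq y x \<longleftrightarrow> y \<in> X \<and> x \<in> X \<and> leq x y \<and> x \<noteq> y \<and>
     (\<forall>z\<in>X. leq x z \<and> leq z y \<longrightarrow> z = x \<or> z = y)"

fun hasse_path :: "'v set \<Rightarrow> ('v \<Rightarrow> 'v \<Rightarrow> bool) \<Rightarrow> 'v list \<Rightarrow> bool" where
  "hasse_path X leq [] = False"
| "hasse_path X leq [x] = (x \<in> X)"
| "hasse_path X leq (y # x # p) = (hasse_arrow X leq y x \<and> hasse_path X leq (x # p))"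

fun path_map :: "('v, 'k::field) qrep \<Rightarrow> 'v list \<Rightarrow> 'k mat" where
  "path_map M [] = 1\<^sub>m 0"
| "path_map M [x] = 1\<^sub>m (rdim M x)"
| "path_map M (y # x # p) = path_map M (x # p) * rmap M y x"

definition poset_modules :: "'v set \<Rightarrow> ('v \<Rightarrow> 'v \<Rightarrow> bool) \<Rightarrow> ('v, 'k::field) qrep set" where
  "poset_modules X leq = {M.
     (\<forall>y x. hasse_arrow X leq y x \<longrightarrow> rmap M y x \<in> carrier_mat (rdim M x) (rdim M y)) \<and>
     (\<forall>p q. hasse_path X leq p \<and> hasse_path X leq q \<and> hd p = hd q \<and> last p = last q \<longrightarrow>
        path_map M p = path_map M q)}"

definition module_hom ::
  "'v set \<Rightarrow> ('v \<Rightarrow> 'v \<Rightarrow> bool) \<Rightarrow> ('v, 'k::field) qrep \<Rightarrow> ('v, 'k) qrep \<Rightarrow> ('v \<Rightarrow> 'k mat) set" where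
  "module_hom X leq M N = {f.
     (\<forall>x\<in>X. f x \<in> carrier_mat (rdim N x) (rdim M x)) \<and>
     (\<forall>y x. hasse_arrow X leq y x \<longrightarrow> f x * rmap M y x = rmap N y x * f y)}"

definition short_exact ::
  "'v set \<Rightarrow> ('v \<Rightarrow> 'v \<Rightarrow> bool) \<Rightarrow> ('v, 'k::field) qrep \<Rightarrow> ('v, 'k) qrep \<Rightarrow> ('v, 'k) qrep \<Rightarrow> bool" where
  "short_exact X leq L M N \<longleftrightarrow>
     (\<exists>f\<in>module_hom X leq L M. \<exists>g\<in>module_hom X leq M N. \<forall>x\<in>X.
        inj_on (\<lambda>v. f x *\<^sub>v v) (carrier_vec (rdim L x)) \<and>
        (\<lambda>v. f x *\<^sub>v v) ` carrier_vec (rdim L x) = mat_kernel (g x) \<and>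
        (\<lambda>v. g x *\<^sub>v v) ` carrier_vec (rdim M x) = carrier_vec (rdim N x))"

definition K0_relations :: "'v set \<Rightarrow> ('v \<Rightarrow> 'v \<Rightarrow> bool) \<Rightarrow> (('v, 'k::field) qrep \<Rightarrow>\<^sub>0 int) set" where
  "K0_relations X leq =
     generate (free_Abelian_group (poset_modules X leq))
       {frag_of M - frag_of L - frag_of N | L M N.
          L \<in> poset_modules X leq \<and> M \<in> poset_modules X leq \<and> N \<in> poset_modules X leq \<and>
          short_exact X leq L M N}"

definition K0 :: "'v set \<Rightarrow> ('v \<Rightarrow> 'v \<Rightarrow> bool) \<Rightarrow> (('v, 'k::field) qrep \<Rightarrow>\<^sub>0 int) set monoid" where
  "K0 X leq = free_Abelian_group (poset_modules X leq) Mod K0_relations X leq"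

definition K0_class ::
  "'v set \<Rightarrow> ('v \<Rightarrow> 'v \<Rightarrow> bool) \<Rightarrow> ('v, 'k::field) qrep \<Rightarrow> (('v, 'k) qrep \<Rightarrow>\<^sub>0 int) set" where
  "K0_class X leq M = K0_relations X leq #>\<^bsub>free_Abelian_group (poset_modules X leq)\<^esub> frag_of M"

definition interval_module :: "'v set \<Rightarrow> ('v, 'k::field) qrep" where
  "interval_module U = \<lparr>
     rdim = (\<lambda>x. if x \<in> U then 1 else 0),
     rmap = (\<lambda>y x. if x \<in> U \<and> y \<in> U then 1\<^sub>m 1
                   else 0\<^sub>m (if x \<in> U then 1 else 0) (if y \<in> U then 1 else 0)) \<rparr>"

text \<open>
  Modulo the relations there is exactly one path from \<open>x\<close> to each \<open>y \<le> x\<close>. Hence the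
  indecomposable projective at \<open>x\<close>, spanned by the paths starting at \<open>x\<close>, is \<open>k\<close> on the elements
  below \<open>x\<close>; dually, the indecomposable injective at \<open>x\<close> is \<open>k\<close> on the elements above \<open>x\<close>.
\<close>

definition proj_module :: "'v set \<Rightarrow> ('v \<Rightarrow> 'v \<Rightarrow> bool) \<Rightarrow> 'v \<Rightarrow> ('v, 'k::field) qrep" where
  "proj_module X leq x = interval_module {y \<in> X. leq y x}"

definition inj_module :: "'v set \<Rightarrow> ('v \<Rightarrow> 'v \<Rightarrow> bool) \<Rightarrow> 'v \<Rightarrow> ('v, 'k::field) qrep" where
  "inj_module X leq x = interval_module {y \<in> X. leq x y}"

lemma path_le:
  assumes "hasse_path X leq p" "\<And>x. leq x x" "\<And>x y z. leq x y \<Longrightarrow> leq y z \<Longrightarrow> leq x z"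
  shows "hd p \<in> X \<and> last p \<in> X \<and> leq (last p) (hd p)"
  using assms(1)
proof (induction p rule: induct_list012)
  case (3 y x p)
  then show ?case using assms(3)[of "last (x#p)" x y] by (auto simp: hasse_arrow_def)
qed (auto simp: assms)

lemma interval_module_in:
  assumes convex: "\<And>x y z. x \<in> U \<Longrightarrow> z \<in> U \<Longrightarrow> y \<in> X \<Longrightarrow> leq x y \<Longrightarrow> leq y z \<Longrightarrow> y \<in> U"
    and refl: "\<And>x. leq x x" and trans: "\<And>x y z. leq x y \<Longrightarrow> leq y z \<Longrightarrow> leq x z"
  shows "(interval_module U :: ('v, 'k::field) qrep) \<in> poset_modules X leq"
proof -
  let ?M = "interval_module U :: ('v, 'k::field) qrep"
  have pm: "path_map ?M p =
     (if hd p \<in> U \<and> last p \<in> U then 1\<^sub>m 1 else 0\<^sub>m (rdim ?M (last p)) (rdim ?M (hd p)))"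
    if "hasse_path X leq p" for p using that
  proof (induction p rule: induct_list012)
    case (2 x) then show ?case by (auto simp: interval_module_def)
  next
    case (3 y x p)
    then have xy: "leq x y" "x \<in> X" "y \<in> X" by (auto simp: hasse_arrow_def)
    have l: "leq (last (x # p)) x" using path_le[of X leq "x # p"] 3 refl trans by auto
    have "x \<in> U" if "y \<in> U" "last (x # p) \<in> U" using convex[OF that(2,1) _ l] xy by auto
    with 3 show ?case by (auto simp: interval_module_def)
  qed auto
  show ?thesis
    unfolding poset_modules_def using pm by (auto simp: interval_module_def)
qed

lemma proj_module_in:
  assumes "\<And>x. leq x x" "\<And>x y z. leq x y \<Longrightarrow> leq y z \<Longrightarrow> leq x z"
  shows "(proj_module X leq x :: ('v, 'k::field) qrep) \<in> poset_modules X leq"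
  unfolding proj_module_def
proof (rule interval_module_in[OF _ assms], goal_cases)
  case (1 a b c)
  then show ?case using assms(2)[of b c x] by simp
qed

lemma inj_module_in:
  assumes "\<And>x. leq x x" "\<And>x y z. leq x y \<Longrightarrow> leq y z \<Longrightarrow> leq x z"
  shows "(inj_module X leq x :: ('v, 'k::field) qrep) \<in> poset_modules X leq"
  unfolding inj_module_def
proof (rule interval_module_in[OF _ assms], goal_cases)
  case (1 a b c)
  then show ?case using assms(2)[of x a b] by simp
qed

lemma tamari_le_refl: "tamari_le x x"
  by (simp add: tamari_le_def)

lemma tamari_le_trans: "tamari_le x y \<Longrightarrow> tamari_le y z \<Longrightarrow> tamari_le x z"
  unfolding tamari_le_def by (rule rtranclp_trans)


type_synonym 'k tamari_K0 = "((pbt, 'k) qrep \<Rightarrow>\<^sub>0 int) set"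

abbreviation K0_Y :: "nat \<Rightarrow> 'k::field tamari_K0 monoid" where
  "K0_Y n \<equiv> K0 (Y n) tamari_le"

abbreviation P_cls :: "nat \<Rightarrow> pbt \<Rightarrow> 'k::field tamari_K0" where
  "P_cls n x \<equiv> K0_class (Y n) tamari_le (proj_module (Y n) tamari_le x)"

abbreviation I_cls :: "nat \<Rightarrow> pbt \<Rightarrow> 'k::field tamari_K0" where
  "I_cls n x \<equiv> K0_class (Y n) tamari_le (inj_module (Y n) tamari_le x)"

end

theory Submission
  imports Defs
begin

text \<open>
  Composition at the last place satisfies \<open>Q\<^sub>x \<circ>\<^sub>m\<^sub>a\<^sub>x Q\<^sub>y = Q\<^bsub>under x y\<^esub>\<close>, so it is the Loday-Ronco product, in which
  sums over up-sets multiply by \<open>up x \<cdot> up y = up (over x y)\<close>. The axioms of an anticyclic operad give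
  \<open>-\<theta>(Q\<^bsub>(x,y)\<^esub>) = -\<theta>(Q\<^sub>x) \<circ>\<^sub>m\<^sub>a\<^sub>x (g \<circ>\<^sub>2 Q\<^sub>y)\<close>, and the relation \<open>g \<circ>\<^sub>2 g = g \<circ>\<^sub>1 g + g \<circ>\<^sub>3 g\<close> gives, for
  \<open>c\<^sub>y = g \<circ>\<^sub>2 Q\<^sub>y\<close>, the recursion \<open>c\<^bsub>(a,b)\<^esub> = c\<^sub>a \<cdot> c\<^sub>b - c\<^sub>a # c\<^sub>b\<close>, where \<open>Q\<^sub>x # Q\<^sub>y = Q\<^bsub>over x y\<^esub>\<close>. In terms of
  simple modules \<open>S\<^sub>x # S\<^sub>y = S\<^bsub>over x y\<^esub>\<close>, and counting the trees above \<open>((|,a),b)\<close> that are not above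
  \<open>(|,(a,b))\<close> yields \<open>c\<^sub>y = up (|,y)\<close>. Hence \<open>-\<theta>(Q\<^sub>x) = up x\<close>, which is the class of the injective
  module \<open>I\<^sub>x\<close>. That these equations determine \<open>\<theta>\<close> follows because the \<open>Q\<^sub>x\<close> span \<open>V\<close>.
\<close>


section \<open>Tamari order and splitting of trees\<close>

text \<open>The over product of Loday and Ronco: \<open>x\<close> is grafted onto the leftmost leaf
  of \<open>y\<close>.\<close>

fun over :: "pbt \<Rightarrow> pbt \<Rightarrow> pbt" where
  "over x Leaf = x"
| "over x (Node u v) = Node (over x u) v"

text \<open>The under product: \<open>y\<close> is grafted onto the rightmost leaf of
  \<open>x\<close>.\<close>

fun under :: "pbt \<Rightarrow> pbt \<Rightarrow> pbt" where
  "under Leaf y = y"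
| "under (Node u v) y = Node u (under v y)"

text \<open>
  Restrictions of a tree, seen as a binary search tree, to its first \<open>m\<close> vertices and to the
  remaining ones.
\<close>

fun lo :: "nat \<Rightarrow> pbt \<Rightarrow> pbt" where
  "lo m Leaf = Leaf"
| "lo m (Node l r) = (if m \<le> vertices l then lo m l else Node l (lo (m - vertices l - 1) r))"

fun hi :: "nat \<Rightarrow> pbt \<Rightarrow> pbt" where
  "hi m Leaf = Leaf"
| "hi m (Node l r) = (if m \<le> vertices l then Node (hi m l) r else hi (m - vertices l - 1) r)"

lemma vertices_over [simp]: "vertices (over x y) = vertices x + vertices y"
  by (induction y) auto

lemma vertices_under [simp]: "vertices (under x y) = vertices x + vertices y"
  by (induction x) auto

lemma vertices_hi: "m \<le> vertices z \<Longrightarrow> vertices (hi m z) = vertices z - m"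
  by (induction z arbitrary: m) auto

lemma vertices_0_iff [simp]: "vertices z = 0 \<longleftrightarrow> z = Leaf"
  by (cases z) auto

lemma lo_0 [simp]: "lo 0 z = Leaf"
  by (induction z) auto

lemma hi_0 [simp]: "hi 0 z = z"
  by (induction z) auto

lemma lo_vertices [simp]: "lo (vertices z) z = z"
  by (induction z) auto

lemma hi_vertices [simp]: "hi (vertices z) z = Leaf"
  by (induction z) auto

lemma lo_over [simp]: "lo (vertices x) (over x y) = x"
  by (induction y) auto

lemma hi_over [simp]: "hi (vertices x) (over x y) = y"
  by (induction y) auto

lemma lo_under [simp]: "lo (vertices x) (under x y) = x"
  by (induction x) auto

lemma hi_under [simp]: "hi (vertices x) (under x y) = y"
  by (induction x) auto

section \<open>Monotonicity of grafting and splitting\<close>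

lemma rotation_vertices: "rotation x y \<Longrightarrow> vertices y = vertices x"
  by (induction rule: rotation.induct) auto

lemma tamari_induct [consumes 1, case_names base step]:
  assumes "tamari_le x y" "R y" "\<And>u v. rotation u v \<Longrightarrow> tamari_le u y \<Longrightarrow> R u \<Longrightarrow> R v"
  shows "R x"
  using assms(1) unfolding tamari_le_def
  by (induction rule: rtranclp_induct) (use assms in \<open>auto simp: tamari_le_def\<close>)

lemma tamari_le_vertices: "tamari_le x y \<Longrightarrow> vertices x = vertices y"
  by (induction rule: tamari_induct) (auto dest: rotation_vertices)

lemma rotation_tamari: "rotation y x \<Longrightarrow> tamari_le x y"
  by (simp add: tamari_le_def r_into_rtranclp)

lemma tamari_mono:
  assumes "\<And>u v. rotation u v \<Longrightarrow> tamari_le (f v) (f u)" "tamari_le x y"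
  shows "tamari_le (f x) (f y)"
  using assms(2) by (induction rule: tamari_induct) (auto intro: assms tamari_le_trans tamari_le_refl)

lemma tamari_Node:
  assumes "tamari_le x x'" "tamari_le y y'"
  shows "tamari_le (Node x y) (Node x' y')"
proof -
  have "tamari_le (Node x y) (Node x' y)"
    using assms(1) by (rule tamari_mono[rotated]) (auto intro: rotation_tamari rotation.intros)
  moreover have "tamari_le (Node x' y) (Node x' y')"
    using assms(2) by (rule tamari_mono[rotated]) (auto intro: rotation_tamari rotation.intros)
  ultimately show ?thesis by (rule tamari_le_trans)
qed

lemma tamari_root: "tamari_le (Node (Node a b) c) (Node a (Node b c))"
  by (rule rotation_tamari) (rule rotation.root)

text \<open>A rotation moves two vertices: it survives in the restriction if both are kept, and
  otherwise the restrictions agree.\<close>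

lemma rotation_lo: "rotation y x \<Longrightarrow> tamari_le (lo m x) (lo m y)"
proof (induction arbitrary: m rule: rotation.induct)
  case (left x x' y)
  then show ?case using rotation_vertices[OF left.hyps] rotation_tamari[OF left.hyps]
    by (simp add: tamari_Node tamari_le_refl)
next
  case (right y y' x)
  then show ?case using rotation_tamari[OF right.hyps] by (simp add: tamari_Node tamari_le_refl)
qed (auto simp: tamari_root tamari_Node tamari_le_refl)

lemma rotation_hi: "rotation y x \<Longrightarrow> tamari_le (hi m x) (hi m y)"
proof (induction arbitrary: m rule: rotation.induct)
  case (left x x' y)
  then show ?case using rotation_vertices[OF left.hyps] rotation_tamari[OF left.hyps]
    by (simp add: tamari_Node tamari_le_refl)
next
  case (right y y' x)
  then show ?case using rotation_tamari[OF right.hyps] by (simp add: tamari_Node tamari_le_refl)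
qed (auto simp: tamari_root tamari_Node tamari_le_refl)

lemma tamari_lo: "tamari_le x y \<Longrightarrow> tamari_le (lo m x) (lo m y)"
  by (rule tamari_mono) (rule rotation_lo)

lemma tamari_hi: "tamari_le x y \<Longrightarrow> tamari_le (hi m x) (hi m y)"
  by (rule tamari_mono) (rule rotation_hi)

lemma tamari_over:
  assumes "tamari_le x x'" "tamari_le y y'"
  shows "tamari_le (over x y) (over x' y')"
proof -
  have 1: "tamari_le (over x y) (over x' y)"
    using assms(1) by (induction y) (auto intro: tamari_Node tamari_le_refl)
  have "rotation u v \<Longrightarrow> rotation (over x' u) (over x' v)" for u v
    by (induction rule: rotation.induct) (auto intro: rotation.intros)
  then have "tamari_le (over x' y) (over x' y')"
    by (intro tamari_mono[of "over x'", OF rotation_tamari assms(2)])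
  with 1 show ?thesis by (rule tamari_le_trans)
qed

lemma tamari_under:
  assumes "tamari_le x x'" "tamari_le y y'"
  shows "tamari_le (under x y) (under x' y')"
proof -
  have 1: "tamari_le (under x y) (under x y')"
    using assms(2) by (induction x) (auto intro: tamari_Node tamari_le_refl)
  have "rotation u v \<Longrightarrow> rotation (under u y') (under v y')" for u v
    by (induction rule: rotation.induct) (auto intro: rotation.intros)
  then have "tamari_le (under x y') (under x' y')"
    by (intro tamari_mono[of "\<lambda>x. under x y'", OF rotation_tamari assms(1)])
  with 1 show ?thesis by (rule tamari_le_trans)
qed

text \<open>Undoing one rotation for each vertex on the left branch of \<open>w\<close> lifts the
  root of \<open>Node l p\<close> to the top.\<close>

lemma over_Node_le: "tamari_le (over (Node l p) w) (Node l (over p w))"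
proof (induction w)
  case (Node a b)
  then show ?case
    by (auto intro: tamari_le_trans[OF tamari_Node[OF Node(1) tamari_le_refl] tamari_root])
qed (simp add: tamari_le_refl)

text \<open>The mirror image, along the right branch of \<open>p\<close>.\<close>

lemma le_under_Node: "tamari_le (Node (under p a) b) (under p (Node a b))"
proof (induction p)
  case (Node c d)
  then show ?case
    by (auto intro: tamari_le_trans[OF tamari_root tamari_Node[OF tamari_le_refl Node(2)]])
qed (simp add: tamari_le_refl)

text \<open>Together with the next lemma: among the trees with given pieces, \<open>over\<close>
  yields the least and \<open>under\<close> the greatest.\<close>

lemma over_lo_hi_le: "tamari_le (over (lo m z) (hi m z)) z"
proof (induction z arbitrary: m)
  case (Node l r)
  show ?case
    using tamari_Node[OF Node.IH(1)[of m] tamari_le_refl[of r]]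
      tamari_le_trans[OF over_Node_le tamari_Node[OF tamari_le_refl[of l] Node.IH(2)[of "m - vertices l - 1"]]]
    by auto
qed (simp add: tamari_le_refl)

lemma le_under_lo_hi: "tamari_le z (under (lo m z) (hi m z))"
proof (induction z arbitrary: m)
  case (Node l r)
  show ?case
    using tamari_le_trans[OF tamari_Node[OF Node.IH(1)[of m] tamari_le_refl[of r]] le_under_Node]
      tamari_Node[OF tamari_le_refl[of l] Node.IH(2)[of "m - vertices l - 1"]]
    by auto
qed (simp add: tamari_le_refl)

text \<open>Splitting and grafting form a Galois connection: both are monotone, and \<open>z\<close>
  lies below \<open>under\<close> of its pieces.\<close>

lemma le_under_iff:
  "tamari_le z (under x y) \<longleftrightarrow> tamari_le (lo (vertices x) z) x \<and> tamari_le (hi (vertices x) z) y"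
  using tamari_lo[of z "under x y" "vertices x"] tamari_hi[of z "under x y" "vertices x"]
    tamari_le_trans[OF le_under_lo_hi[of z "vertices x"] tamari_under] by auto

text \<open>The dual connection, for grafting by \<open>over\<close>.\<close>

lemma over_le_iff:
  "tamari_le (over x y) z \<longleftrightarrow> tamari_le x (lo (vertices x) z) \<and> tamari_le y (hi (vertices x) z)"
  using tamari_lo[of "over x y" z "vertices x"] tamari_hi[of "over x y" z "vertices x"]
    tamari_le_trans[OF tamari_over over_lo_hi_le[of "vertices x" z]] by auto

section \<open>Down-sets of \<open>over\<close> and up-sets of trees with empty left subtree\<close>

lemma rotation_over_cases:
  "rotation (over x y) z \<Longrightarrow>
    (\<exists>x'. z = over x' y \<and> rotation x x') \<or> (\<exists>y'. z = over x y' \<and> rotation y y')"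
proof (induction y arbitrary: z)
  case (Node a b)
  from Node.prems show ?case
  proof (cases rule: rotation.cases)
    case (root p q r)
    then have "z = over x (Node (Node a q) r)" "b = Node q r" by simp_all
    then show ?thesis by (blast intro: rotation.root)
  next
    case (left p p' q)
    then show ?thesis using Node.IH(1)[of p']
      by (metis over.simps(2) pbt.inject rotation.left)
  next
    case (right p p' q)
    then show ?thesis by (metis over.simps(2) pbt.inject rotation.right)
  qed
qed auto

text \<open>The edge by which \<open>x\<close> is grafted is a left edge, while a rotation consumes
  a right edge. So every rotation in a chain starting at \<open>over x y\<close> takes place inside
  one of the two parts.\<close>

lemma le_over_iff:
  "tamari_le z (over x y) \<longleftrightarrow> (\<exists>x' y'. z = over x' y' \<and> tamari_le x' x \<and> tamari_le y' y)"
proof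
  assume "tamari_le z (over x y)"
  then show "\<exists>x' y'. z = over x' y' \<and> tamari_le x' x \<and> tamari_le y' y"
  proof (induction rule: tamari_induct)
    case base
    then show ?case using tamari_le_refl by blast
  next
    case (step u v)
    then obtain x' y' where u: "u = over x' y'" and le: "tamari_le x' x" "tamari_le y' y" by blast
    from rotation_over_cases[OF step(1)[unfolded u]] show ?case
    proof (elim disjE exE conjE)
      fix w assume "v = over w y'" "rotation x' w"
      then show ?thesis using tamari_le_trans[OF rotation_tamari le(1)] le(2) by blast
    next
      fix w assume "v = over x' w" "rotation y' w"
      then show ?thesis using tamari_le_trans[OF rotation_tamari le(2)] le(1) by blast
    qed
  qed
qed (auto intro: tamari_over)

lemma rotation_to_Leaf [simp]: "\<not> rotation x Leaf"
proof
  assume "rotation x Leaf"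
  then show False by cases
qed

lemma rotation_to_Node_Leaf:
  assumes "rotation u (Node Leaf b)"
  obtains c where "u = Node Leaf c" "rotation c b"
  using assms by (cases rule: rotation.cases) (simp_all add: that)

text \<open>A rotation at the root produces a nonempty left subtree, so a tree with empty left
  subtree arises only by rotations in the right subtree.\<close>

lemma Node_Leaf_le_iff:
  "tamari_le (Node Leaf a) z \<longleftrightarrow> (\<exists>a'. z = Node Leaf a' \<and> tamari_le a a')"
proof
  have "tamari_le x z \<Longrightarrow> x = Node Leaf a \<Longrightarrow> \<exists>a'. z = Node Leaf a' \<and> tamari_le a a'" for x a
    unfolding tamari_le_def
  proof (induction z rule: converse_rtranclp_induct)
    case (step u v)
    then obtain b where "v = Node Leaf b" "rotation\<^sup>*\<^sup>* b a" by blast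
    moreover from step(1) this(1) obtain c where "u = Node Leaf c" "rotation c b"
      using rotation_to_Node_Leaf by blast
    ultimately show ?case using converse_rtranclp_into_rtranclp[of rotation c b a] by blast
  qed auto
  then show "tamari_le (Node Leaf a) z \<Longrightarrow> \<exists>a'. z = Node Leaf a' \<and> tamari_le a a'" by blast
qed (auto intro: tamari_Node tamari_le_refl)

text \<open>The tree on the left is \<open>((|,a),b)\<close>. Cutting \<open>z\<close> after the
  vertices of \<open>(|,a)\<close> gives two pieces with empty left subtree; the alternatives are
  whether the root of \<open>z\<close> lies before or after the cut.\<close>

lemma over_comb_le_iff:
  "tamari_le (over (Node Leaf a) (Node Leaf b)) z \<longleftrightarrow>
     tamari_le (Node Leaf (Node a b)) z \<or>
     (\<exists>u v. z = over u v \<and> tamari_le (Node Leaf a) u \<and> tamari_le (Node Leaf b) v)"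
  (is "?L \<longleftrightarrow> ?R1 \<or> ?R2")
proof (intro iffI)
  assume ?L
  let ?m = "vertices (Node Leaf a)"
  from \<open>?L\<close> obtain a' b' where lo: "lo ?m z = Node Leaf a'" and a: "tamari_le a a'"
    and hi: "hi ?m z = Node Leaf b'" and b: "tamari_le b b'"
    unfolding over_le_iff Node_Leaf_le_iff by blast
  obtain l r where z: "z = Node l r" using lo by (cases z) auto
  show "?R1 \<or> ?R2"
  proof (cases "?m \<le> vertices l")
    \<comment> \<open>The root lies after the cut: \<open>l\<close> is exactly the first piece, and
      \<open>z\<close> is an \<open>over\<close>.\<close>
    case True
    with z lo hi have l: "lo ?m l = Node Leaf a'" "hi ?m l = Leaf" "r = b'" by auto
    with vertices_hi[OF True] True have "vertices l = ?m" by simp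
    then have "l = Node Leaf a'" using l(1) lo_vertices[of l] by simp
    then have "z = over (Node Leaf a') (Node Leaf b')" using z l by simp
    then show ?thesis using a b tamari_Node tamari_le_refl by blast
  next
    \<comment> \<open>The root lies before the cut: \<open>l\<close> is empty, and \<open>r\<close>
      lies above \<open>over a (Node Leaf b)\<close>, which is \<open>(a,b)\<close>.\<close>
    case False
    with z lo hi have "l = Leaf" "lo (vertices a) r = a'" "hi (vertices a) r = Node Leaf b'" by auto
    moreover from this have "tamari_le (over a (Node Leaf b)) r"
      unfolding over_le_iff using a b by (auto intro: tamari_Node tamari_le_refl)
    ultimately show ?thesis using z by (auto intro: tamari_Node tamari_le_refl)
  qed
next
  assume "?R1 \<or> ?R2"
  then show ?L
  proof
    assume ?R1
    then show ?L using tamari_le_trans[OF tamari_root[of Leaf a b], of z] by simp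
  next
    assume ?R2
    then obtain u v where "z = over u v" "tamari_le (Node Leaf a) u" "tamari_le (Node Leaf b) v" by blast
    then show ?L using tamari_over[of "Node Leaf a" u "Node Leaf b" v] by simp
  qed
qed

text \<open>The first condition makes the left subtree of \<open>z\<close> empty, the others make it
  nonempty.\<close>

lemma over_comb_disjoint:
  assumes "tamari_le (Node Leaf c) z" "z = over u v"
    "tamari_le (Node Leaf a) u" "tamari_le (Node Leaf b) v"
  shows False
  using assms by (auto simp: Node_Leaf_le_iff)

lemma finite_Y: "finite (Y n)"
proof -
  have "finite {z. vertices z \<le> n}"
  proof (induction n)
    case (Suc n)
    let ?A = "{z. vertices z \<le> n}"
    have "z \<in> insert Leaf (case_prod Node ` (?A \<times> ?A))" if "vertices z \<le> Suc n" for z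
      using that by (cases z) auto
    then have "{z. vertices z \<le> Suc n} \<subseteq> insert Leaf (case_prod Node ` (?A \<times> ?A))" by blast
    then show ?case by (rule finite_subset) (simp add: Suc)
  qed simp
  then show ?thesis by (rule finite_subset[rotated]) (auto simp: Y_def)
qed

lemma finite_up: "finite {z. tamari_le x z}"
  by (rule finite_subset[OF _ finite_Y[of "vertices x"]]) (auto simp: Y_def dest: tamari_le_vertices)


section \<open>Formal sums of trees\<close>

definition bil :: "('a \<Rightarrow> 'b \<Rightarrow> 'c \<Rightarrow>\<^sub>0 int) \<Rightarrow> ('a \<Rightarrow>\<^sub>0 int) \<Rightarrow> ('b \<Rightarrow>\<^sub>0 int) \<Rightarrow> ('c \<Rightarrow>\<^sub>0 int)" where
  "bil h f g = frag_extend (\<lambda>x. frag_extend (h x) g) f"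

lemma frag_cmul_diff2: "frag_cmul k (x - y) = frag_cmul k x - frag_cmul k y"
  using frag_cmul_distrib2[of k "x - y" y] by simp

lemma bil_simps [simp]:
  "bil h 0 g = 0" "bil h f 0 = 0"
  "bil h (frag_of x) (frag_of y) = h x y"
  "bil h (f - f') g = bil h f g - bil h f' g"
  "bil h f (g - g') = bil h f g - bil h f g'"
proof -
  show "bil h f (g - g') = bil h f g - bil h f g'"
    unfolding bil_def frag_extend_diff
    by (simp add: frag_extend_def frag_cmul_diff2 sum_subtractf)
qed (auto simp: bil_def frag_extend_diff intro: frag_extend_eq_0)

lemma bil_keys:
  assumes "Poly_Mapping.keys f \<subseteq> A" "Poly_Mapping.keys g \<subseteq> B"
    "\<And>x y. x \<in> A \<Longrightarrow> y \<in> B \<Longrightarrow> Poly_Mapping.keys (h x y) \<subseteq> C"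
  shows "Poly_Mapping.keys (bil h f g) \<subseteq> C"
proof -
  have "Poly_Mapping.keys (frag_extend (h x) g) \<subseteq> C" if "x \<in> A" for x
    by (rule order.trans[OF keys_frag_extend]) (use assms that in blast)
  then show ?thesis
    unfolding bil_def by (intro order.trans[OF keys_frag_extend]) (use assms(1) in blast)
qed

text \<open>Differences suffice, since a free abelian group is generated from its basis by
  subtraction.\<close>

lemma bil_ind:
  assumes f: "Poly_Mapping.keys f \<subseteq> A" and g: "Poly_Mapping.keys g \<subseteq> B"
    and zero: "\<And>g. R 0 g" "\<And>f. R f 0"
    and diff: "\<And>f f' g. R f g \<Longrightarrow> R f' g \<Longrightarrow> R (f - f') g"
      "\<And>f g g'. R f g \<Longrightarrow> R f g' \<Longrightarrow> R f (g - g')"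
    and of: "\<And>x y. x \<in> A \<Longrightarrow> y \<in> B \<Longrightarrow> R (frag_of x) (frag_of y)"
  shows "R f g"
  using f
proof (induction f rule: frag_induct)
  case (single x)
  show ?case
    using g by (induction g rule: frag_induct) (auto intro: zero diff of single)
qed (auto intro: zero diff)

definition fsum :: "'a set \<Rightarrow> 'a \<Rightarrow>\<^sub>0 int" where
  "fsum A = (\<Sum>a\<in>A. frag_of a)"

lemma frag_extend_fsum: "finite A \<Longrightarrow> frag_extend h (fsum A) = (\<Sum>a\<in>A. h a)"
  by (simp add: fsum_def frag_extend_sum)

lemma bil_fsum:
  assumes "finite A" "finite B"
  shows "bil h (fsum A) (fsum B) = (\<Sum>a\<in>A. \<Sum>b\<in>B. h a b)"
  using assms by (simp add: bil_def frag_extend_fsum)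

abbreviation frag_under :: "(pbt \<Rightarrow>\<^sub>0 int) \<Rightarrow> (pbt \<Rightarrow>\<^sub>0 int) \<Rightarrow> (pbt \<Rightarrow>\<^sub>0 int)" where
  "frag_under \<equiv> bil (\<lambda>x y. frag_of (under x y))"

abbreviation frag_over :: "(pbt \<Rightarrow>\<^sub>0 int) \<Rightarrow> (pbt \<Rightarrow>\<^sub>0 int) \<Rightarrow> (pbt \<Rightarrow>\<^sub>0 int)" where
  "frag_over \<equiv> bil (\<lambda>x y. frag_of (over x y))"

text \<open>
  The product of the Loday-Ronco algebra of planar binary trees, in the basis that corresponds to
  the simple modules.
\<close>

abbreviation loday_ronco :: "(pbt \<Rightarrow>\<^sub>0 int) \<Rightarrow> (pbt \<Rightarrow>\<^sub>0 int) \<Rightarrow> (pbt \<Rightarrow>\<^sub>0 int)" where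
  "loday_ronco \<equiv> bil (\<lambda>x y. fsum {z \<in> Y (vertices x + vertices y).
     lo (vertices x) z = x \<and> hi (vertices x) z = y})"

text \<open>Change of basis from projectives to simples: the sum over \<open>z \<le> x\<close>
  expands \<open>P_x\<close> in the \<open>S_z\<close>.\<close>

definition zeta :: "(pbt \<Rightarrow>\<^sub>0 int) \<Rightarrow> (pbt \<Rightarrow>\<^sub>0 int)" where
  "zeta = frag_extend (\<lambda>x. fsum {z. tamari_le z x})"

lemma zeta_simps [simp]:
  "zeta 0 = 0" "zeta (f - g) = zeta f - zeta g" "zeta (frag_of x) = fsum {z. tamari_le z x}"
  by (simp_all add: zeta_def frag_extend_diff)

text \<open>The fibres of the splitting map are disjoint, so a product of two sums runs over a
  preimage without repetition.\<close>

lemma loday_ronco_fsum: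
  assumes "A \<subseteq> Y m" "B \<subseteq> Y n"
  shows "loday_ronco (fsum A) (fsum B) = fsum {z \<in> Y (m + n). lo m z \<in> A \<and> hi m z \<in> B}"
proof -
  have fin: "finite A" "finite B" using finite_subset[OF assms(1) finite_Y] finite_subset[OF assms(2) finite_Y] by auto
  let ?F = "\<lambda>x y. {z \<in> Y (m + n). lo m z = x \<and> hi m z = y}"
  have "loday_ronco (fsum A) (fsum B) = (\<Sum>x\<in>A. \<Sum>y\<in>B. fsum (?F x y))"
    unfolding bil_fsum[OF fin] using assms by (intro sum.cong refl) (auto simp: Y_def subset_iff)
  also have "\<dots> = (\<Sum>p\<in>A \<times> B. \<Sum>z\<in>?F (fst p) (snd p). frag_of z)"
    by (simp add: fsum_def sum.cartesian_product case_prod_beta)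
  also have "\<dots> = (\<Sum>z\<in>(\<Union>p\<in>A \<times> B. ?F (fst p) (snd p)). frag_of z)"
    by (rule sum.UNION_disjoint[symmetric]) (use fin finite_Y in auto)
  also have "(\<Union>p\<in>A \<times> B. ?F (fst p) (snd p)) = {z \<in> Y (m + n). lo m z \<in> A \<and> hi m z \<in> B}"
    by auto
  finally show ?thesis by (simp add: fsum_def)
qed

text \<open>Once the size of \<open>x\<close> is known, \<open>over x y\<close> determines both
  factors, so no tree is counted twice.\<close>

lemma frag_over_fsum:
  assumes "A \<subseteq> Y m" "B \<subseteq> Y n"
  shows "frag_over (fsum A) (fsum B) = fsum {over x y | x y. x \<in> A \<and> y \<in> B}"
proof -
  have fin: "finite A" "finite B" using finite_subset[OF assms(1) finite_Y] finite_subset[OF assms(2) finite_Y] by auto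
  have inj: "inj_on (\<lambda>p. over (fst p) (snd p)) (A \<times> B)"
  proof (rule inj_onI, clarsimp)
    fix x y x' y' assume "over x y = over x' y'" "x \<in> A" "x' \<in> A"
    moreover have "vertices x = vertices x'" using calculation assms by (auto simp: Y_def)
    ultimately show "x = x' \<and> y = y'" by (metis lo_over hi_over)
  qed
  have "frag_over (fsum A) (fsum B) = (\<Sum>p\<in>A \<times> B. frag_of (over (fst p) (snd p)))"
    using fin by (simp add: bil_fsum sum.cartesian_product case_prod_beta)
  also have "\<dots> = fsum ((\<lambda>p. over (fst p) (snd p)) ` (A \<times> B))"
    unfolding fsum_def by (simp add: sum.reindex[OF inj])
  also have "(\<lambda>p. over (fst p) (snd p)) ` (A \<times> B) = {over x y | x y. x \<in> A \<and> y \<in> B}"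
    by force
  finally show ?thesis .
qed

lemma down_Y: "{z. tamari_le z x} \<subseteq> Y (vertices x)" and up_Y: "{z. tamari_le x z} \<subseteq> Y (vertices x)"
  by (auto simp: Y_def dest: tamari_le_vertices)

text \<open>By \<open>le_under_iff\<close>, the down-set of \<open>under x y\<close> is the preimage
  under splitting of the two down-sets.\<close>

lemma zeta_frag_under: "zeta (frag_under f g) = loday_ronco (zeta f) (zeta g)"
proof (rule bil_ind[of f UNIV g UNIV])
  fix x y
  have "{z \<in> Y (vertices x + vertices y). tamari_le (lo (vertices x) z) x \<and> tamari_le (hi (vertices x) z) y}
      = {z. tamari_le z (under x y)}"
    using down_Y[of "under x y"] by (auto simp: le_under_iff)
  then show "zeta (frag_under (frag_of x) (frag_of y)) = loday_ronco (zeta (frag_of x)) (zeta (frag_of y))"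
    by (simp add: loday_ronco_fsum[OF down_Y down_Y])
qed simp_all

text \<open>By \<open>le_over_iff\<close>, the product \<open>over\<close> has the same formula in
  both bases.\<close>

lemma zeta_frag_over: "zeta (frag_over f g) = frag_over (zeta f) (zeta g)"
proof (rule bil_ind[of f UNIV g UNIV])
  fix x y
  show "zeta (frag_over (frag_of x) (frag_of y)) = frag_over (zeta (frag_of x)) (zeta (frag_of y))"
    by (simp add: frag_over_fsum[OF down_Y down_Y] le_over_iff)
qed simp_all

abbreviation up :: "pbt \<Rightarrow> pbt \<Rightarrow>\<^sub>0 int" where
  "up x \<equiv> fsum {z. tamari_le x z}"

text \<open>By \<open>over_le_iff\<close>. Thus injectives multiply by \<open>over\<close> where
  projectives multiply by \<open>under\<close>.\<close>

lemma loday_ronco_up: "loday_ronco (up x) (up y) = up (over x y)"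
proof -
  have "{z \<in> Y (vertices x + vertices y). tamari_le x (lo (vertices x) z) \<and> tamari_le y (hi (vertices x) z)}
      = {z. tamari_le (over x y) z}"
    using up_Y[of "over x y"] by (auto simp: over_le_iff)
  then show ?thesis by (simp add: loday_ronco_fsum[OF up_Y up_Y])
qed

text \<open>\<open>\<gamma> y\<close> stands for \<open>g \<circ>\<^sub>2 Q\<^sub>y\<close>, and \<open>\<rho> x\<close> for \<open>-\<theta>(Q\<^sub>x)\<close>.\<close>

fun \<gamma> :: "pbt \<Rightarrow> pbt \<Rightarrow>\<^sub>0 int" where
  "\<gamma> Leaf = frag_of (Node Leaf Leaf)"
| "\<gamma> (Node a b) = frag_under (\<gamma> a) (\<gamma> b) - frag_over (\<gamma> a) (\<gamma> b)"

fun \<rho> :: "pbt \<Rightarrow> pbt \<Rightarrow>\<^sub>0 int" where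
  "\<rho> Leaf = frag_of Leaf"
| "\<rho> (Node x y) = frag_under (\<rho> x) (\<gamma> y)"

lemma \<gamma>_keys: "Poly_Mapping.keys (\<gamma> y) \<subseteq> Y (vertices y + 1)"
proof (induction y)
  case (Node a b)
  then show ?case
    unfolding \<gamma>.simps by (intro keys_diffI bil_keys[OF Node.IH]) (auto simp: Y_def)
qed (simp add: Y_def)

lemma \<rho>_keys: "Poly_Mapping.keys (\<rho> x) \<subseteq> Y (vertices x)"
proof (induction x)
  case (Node x y)
  then show ?case
    unfolding \<rho>.simps by (intro bil_keys[OF _ \<gamma>_keys]) (auto simp: Y_def)
qed (simp add: Y_def)

lemma Leaf_le_iff: "tamari_le Leaf z \<longleftrightarrow> z = Leaf" "tamari_le z Leaf \<longleftrightarrow> z = Leaf"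
  using tamari_le_vertices[of Leaf z] tamari_le_vertices[of z Leaf] tamari_le_refl by auto

text \<open>In simple classes the first term of the recursion is the up-set of
  \<open>((|,a),b)\<close>, and the second consists of the trees \<open>over u v\<close> with
  \<open>u\<close> above \<open>(|,a)\<close> and \<open>v\<close> above \<open>(|,b)\<close>. By
  \<open>over_comb_le_iff\<close> their difference is the up-set of
  \<open>(|,(a,b))\<close>.\<close>

lemma zeta_\<gamma>: "zeta (\<gamma> y) = up (Node Leaf y)"
proof (induction y)
  case Leaf
  have "tamari_le z (Node Leaf Leaf) \<longleftrightarrow> z = Node Leaf Leaf" for z
    using tamari_le_vertices[of z "Node Leaf Leaf"] by (cases z) (auto simp: tamari_le_refl)
  then show ?case by (simp add: Node_Leaf_le_iff Leaf_le_iff)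
next
  case (Node a b)
  let ?a = "Node Leaf a" and ?b = "Node Leaf b"
  let ?S = "{z. tamari_le (Node Leaf (Node a b)) z}" and ?T = "{over u v | u v. tamari_le ?a u \<and> tamari_le ?b v}"
  have T: "?S \<union> ?T = {z. tamari_le (over ?a ?b) z}"
    unfolding over_comb_le_iff by auto
  have "finite ?T" by (rule finite_subset[OF _ finite_up[of "over ?a ?b"]]) (use T in blast)
  moreover have "?S \<inter> ?T = {}" using over_comb_disjoint by blast
  ultimately have "up (over ?a ?b) = fsum ?S + fsum ?T"
    unfolding fsum_def T[symmetric] by (intro sum.union_disjoint finite_up)
  moreover have "zeta (\<gamma> (Node a b)) = up (over ?a ?b) - fsum ?T"
    by (simp add: zeta_frag_under zeta_frag_over Node.IH loday_ronco_up frag_over_fsum[OF up_Y up_Y])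
  ultimately show ?case by simp
qed

text \<open>Holds because \<open>over x (Node Leaf y) = Node x y\<close>.\<close>

lemma zeta_\<rho>: "zeta (\<rho> x) = up x"
  by (induction x) (simp_all add: Leaf_le_iff zeta_frag_under zeta_\<gamma> loday_ronco_up)


section \<open>Formal compositions modulo the relations of \<open>V\<close>\<close>

text \<open>Indexed by the weight \<open>n\<close>, with degree \<open>2 * n + 1\<close>:
  composition then adds indices, and no truncated subtraction occurs.\<close>

abbreviation vin :: "nat \<Rightarrow> (opmono \<Rightarrow>\<^sub>0 int) \<Rightarrow> bool" where
  "vin n a \<equiv> Poly_Mapping.keys a \<subseteq> opmonos (2 * n + 1)"

definition veq :: "nat \<Rightarrow> (opmono \<Rightarrow>\<^sub>0 int) \<Rightarrow> (opmono \<Rightarrow>\<^sub>0 int) \<Rightarrow> bool" where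
  "veq n a b \<longleftrightarrow> vrel (2 * n + 1) (a - b)"

lemma vcls_eq_veq: "vcls (2 * n + 1) a = vcls (2 * n + 1) b \<longleftrightarrow> veq n a b"
  by (simp add: vcls_eq_iff veq_def)

lemma veq_refl [simp]: "veq n a a"
  by (simp add: veq_def vrel.zero)

lemma veq_sym: "veq n a b \<Longrightarrow> veq n b a"
  using vrel_minus[of "2 * n + 1" "a - b"] by (simp add: veq_def)

lemma veq_trans [trans]: "veq n a b \<Longrightarrow> veq n b c \<Longrightarrow> veq n a c"
  using vrel_add[of "2 * n + 1" "a - b" "b - c"] by (simp add: veq_def)

lemma veq_add: "veq n a b \<Longrightarrow> veq n c d \<Longrightarrow> veq n (a + c) (b + d)"
  using vrel_add[of "2 * n + 1" "a - b" "c - d"] by (simp add: veq_def algebra_simps)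

lemma veq_diff: "veq n a b \<Longrightarrow> veq n c d \<Longrightarrow> veq n (a - c) (b - d)"
  using vrel.diff[of "2 * n + 1" "a - b" "c - d"] by (simp add: veq_def algebra_simps)

lemma veq_cmul: "veq n a b \<Longrightarrow> veq n (frag_cmul k a) (frag_cmul k b)"
  unfolding veq_def frag_cmul_diff2[symmetric]
  by (rule frag_closure_minus_cmul) (auto intro: vrel.intros)

lemma keys_cmulI [simp]: "Poly_Mapping.keys a \<subseteq> S \<Longrightarrow> Poly_Mapping.keys (frag_cmul k a) \<subseteq> S"
  by (rule order.trans[OF keys_cmul])

lemma vin_mcomp: "vin m a \<Longrightarrow> vin n b \<Longrightarrow> 1 \<le> i \<Longrightarrow> i \<le> 2 * m + 1 \<Longrightarrow> vin (m + n) (mcomp i a b)"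
  using mcomp_mfree[of a "2 * m + 1" b "2 * n + 1" i] by (simp add: algebra_simps)

lemma veq_left:
  "veq m a a' \<Longrightarrow> vin n b \<Longrightarrow> 1 \<le> i \<Longrightarrow> i \<le> 2 * m + 1 \<Longrightarrow> veq (m + n) (mcomp i a b) (mcomp i a' b)"
  using vrel_mcomp_left[of "2 * m + 1" "a - a'" b "2 * n + 1" i]
  by (simp add: veq_def mcomp_simps algebra_simps)

lemma veq_right:
  "veq n b b' \<Longrightarrow> vin m a \<Longrightarrow> 1 \<le> i \<Longrightarrow> i \<le> 2 * m + 1 \<Longrightarrow> veq (m + n) (mcomp i a b) (mcomp i a b')"
  using vrel_mcomp_right[of "2 * n + 1" "b - b'" a "2 * m + 1" i]
  by (simp add: veq_def mcomp_simps algebra_simps)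

lemma mcomp_cmul [simp]:
  "mcomp i (frag_cmul k a) b = frag_cmul k (mcomp i a b)"
  "mcomp i a (frag_cmul k b) = frag_cmul k (mcomp i a b)"
  unfolding mcomp_def frag_extend_cmul
  by (simp_all add: frag_extend_def frag_cmul_sum mult_ac)

lemma mcomp_minus [simp]: "mcomp i (- a) b = - mcomp i a b" "mcomp i a (- b) = - mcomp i a b"
  using mcomp_cmul(1)[of i "-1" a b] mcomp_cmul(2)[of i a "-1" b] by simp_all

text \<open>The place \<open>k\<close> and the weight \<open>N\<close> are tied only by equations,
  so that the rule applies whatever the form of the arithmetic.\<close>

lemma veq_assoc:
  assumes "vin m a" "vin n b" "vin r c" "1 \<le> i" "i \<le> 2 * m + 1" "1 \<le> j" "j \<le> 2 * n + 1"
    and "k = j + i - 1" "N = m + n + r"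
  shows "veq N (mcomp k (mcomp i a b) c) (mcomp i a (mcomp j b c))"
  using vrel_mcomp_assoc[OF assms(1-7)] assms(8,9) by (simp add: veq_def algebra_simps)

text \<open>Degree determines weight, so Koszul signs can be read off from degrees.\<close>

lemma opmonos_wt: "opmonos (2 * n + 1) = {t \<in> opmonos (2 * n + 1). mwt t = int n}"
  using mdeg_mwt by (fastforce simp: opmonos_def)

lemma ksgn_int: "ksgn (int n) = (- 1) ^ n"
  by (simp add: ksgn_def)

lemma veq_commute:
  assumes "vin m a" "vin n b" "vin r c" "1 \<le> i" "i < j" "j \<le> 2 * m + 1"
    and "k = j + 2 * n" "N = m + n + r"
  shows "veq N (mcomp k (mcomp i a b) c) (frag_cmul ((- 1) ^ (n * r)) (mcomp i (mcomp j a c) b))"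
proof -
  have "Poly_Mapping.keys b \<subseteq> {t \<in> opmonos (2 * n + 1). mwt t = int n}"
    "Poly_Mapping.keys c \<subseteq> {t \<in> opmonos (2 * r + 1). mwt t = int r}"
    using assms(2,3) opmonos_wt[of n] opmonos_wt[of r] by auto
  from vrel_mcomp_commute[OF assms(1) this assms(4-6)] show ?thesis
    using assms(7,8) by (simp add: veq_def algebra_simps flip: ksgn_int)
qed

lemma veq_unit_left: "vin n b \<Longrightarrow> veq n (mcomp 1 (frag_of MUnit) b) b"
proof (induction b rule: frag_induct)
  case (single t)
  then show ?case using vrel.unit_left[of t] by (auto simp: veq_def opmonos_def mcomp_simps)
qed (auto simp: mcomp_simps intro: veq_diff)

lemma veq_unit_right:
  assumes "1 \<le> i" "i \<le> 2 * m + 1"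
  shows "vin m a \<Longrightarrow> veq m (mcomp i a (frag_of MUnit)) a"
proof (induction a rule: frag_induct)
  case (single t)
  then show ?case using vrel.unit_right[of t i] assms by (auto simp: veq_def opmonos_def mcomp_simps)
qed (auto simp: mcomp_simps intro: veq_diff)

section \<open>Representatives of the \<open>Q_x\<close> and their products at the last and first
  inputs\<close>

abbreviation gen :: "opmono \<Rightarrow>\<^sub>0 int" where
  "gen \<equiv> frag_of MGen"

abbreviation unit :: "opmono \<Rightarrow>\<^sub>0 int" where
  "unit \<equiv> frag_of MUnit"

lemma vin_gen: "vin 1 gen" and vin_unit: "vin 0 unit"
  by (auto simp: opmonos_def)

lemma veq_relation: "veq 2 (mcomp 2 gen gen) (mcomp 1 gen gen + mcomp 3 gen gen)"
  using vrel_minus[OF vrel.relation] by (simp add: veq_def mcomp_simps algebra_simps)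

text \<open>A representative of \<open>Q x\<close> before passing to classes;
  \<open>2 * vertices x + 3\<close> is the last input of
  \<open>mcomp 1 gen (qtree x)\<close>.\<close>

fun qtree :: "pbt \<Rightarrow> opmono \<Rightarrow>\<^sub>0 int" where
  "qtree Leaf = unit"
| "qtree (Node x y) = frag_cmul ((- 1) ^ vertices x)
     (mcomp (2 * vertices x + 3) (mcomp 1 gen (qtree x)) (qtree y))"

lemma vin_gen_qtree: "vin m a \<Longrightarrow> vin (m + 1) (mcomp 1 gen a)"
  using vin_mcomp[OF vin_gen, of a m 1] by (simp add: add.commute)

lemma vin_qtree: "vin (vertices x) (qtree x)"
proof (induction x)
  case (Node x y)
  from vin_mcomp[OF vin_gen_qtree[OF Node.IH(1)] Node.IH(2), of "2 * vertices x + 3"]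
  show ?case by (simp add: algebra_simps)
qed (use vin_unit in simp)

lemma Q_qtree: "Q x = vcls (2 * vertices x + 1) (qtree x)"
proof (induction x)
  case Leaf
  then show ?case by (simp add: V_operad_def)
next
  case (Node x y)
  let ?p = "vertices x" and ?q = "vertices y"
  have d: "3 + (2 * ?p + 1) - 1 = 2 * ?p + 1 + 2" "2 * ?p + 1 + 2 + (2 * ?q + 1) - 1 = 2 * ?p + 1 + (2 * ?q + 1) + 1"
    by simp_all
  have g: "Poly_Mapping.keys gen \<subseteq> opmonos 3" using vin_gen by simp
  have 1: "op_comp V_operad 3 (2 * ?p + 1) 1 V_gen (Q x) = vcls (2 * ?p + 1 + 2) (mcomp 1 gen (qtree x))"
    unfolding Node V_gen_def using op_comp_vcls[OF g vin_qtree[of x], of 1] unfolding d by simp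
  have k: "Poly_Mapping.keys (mcomp 1 gen (qtree x)) \<subseteq> opmonos (2 * ?p + 1 + 2)"
    using vin_gen_qtree[OF vin_qtree[of x]] by (simp add: algebra_simps)
  have 2: "op_comp V_operad (2 * ?p + 1 + 2) (2 * ?q + 1) (2 * ?p + 1 + 2)
      (op_comp V_operad 3 (2 * ?p + 1) 1 V_gen (Q x)) (Q y) =
      vcls (2 * ?p + 1 + (2 * ?q + 1) + 1) (mcomp (2 * ?p + 3) (mcomp 1 gen (qtree x)) (qtree y))"
    unfolding 1 Node(2) using op_comp_vcls[OF k vin_qtree[of y], of "2 * ?p + 1 + 2"] unfolding d
    by (simp add: numeral_3_eq_3)
  have "Poly_Mapping.keys (mcomp (2 * ?p + 3) (mcomp 1 gen (qtree x)) (qtree y))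
      \<subseteq> opmonos (2 * ?p + 1 + (2 * ?q + 1) + 1)"
    using mcomp_mfree[OF k vin_qtree[of y], of "2 * ?p + 3"] unfolding d by simp
  from vcls_int_pow[OF this] 2 show ?case
    by (simp add: Let_def ksgn_int algebra_simps)
qed

definition qfrag :: "(pbt \<Rightarrow>\<^sub>0 int) \<Rightarrow> (opmono \<Rightarrow>\<^sub>0 int)" where
  "qfrag = frag_extend qtree"

lemma qfrag_simps [simp]:
  "qfrag 0 = 0" "qfrag (f - g) = qfrag f - qfrag g" "qfrag (frag_of x) = qtree x"
  "qfrag (- f) = - qfrag f" "qfrag (frag_cmul k f) = frag_cmul k (qfrag f)"
  by (simp_all add: qfrag_def frag_extend_diff frag_extend_minus frag_extend_cmul)

lemma vin_qfrag: "Poly_Mapping.keys f \<subseteq> Y n \<Longrightarrow> vin n (qfrag f)"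
proof (induction f rule: frag_induct)
  case (diff f g)
  then show ?case unfolding qfrag_simps by (intro keys_diffI)
next
  case (single x)
  then show ?case using vin_qtree[of x] by (simp add: Y_def)
qed simp

text \<open>Associativity carries the composition at the last input down the right branch of
  \<open>x\<close>; no sign arises.\<close>

lemma qtree_under:
  "veq (vertices x + vertices y) (mcomp (2 * vertices x + 1) (qtree x) (qtree y)) (qtree (under x y))"
proof (induction x)
  case Leaf
  show ?case using veq_unit_left[OF vin_qtree[of y]] by simp
next
  case (Node u v)
  let ?A = "mcomp 1 gen (qtree u)" and ?N = "vertices u + 1 + vertices v + vertices y"
  have A: "vin (vertices u + 1) ?A" by (rule vin_gen_qtree[OF vin_qtree])
  have "veq ?N (mcomp (2 * vertices (Node u v) + 1) (mcomp (2 * vertices u + 3) ?A (qtree v)) (qtree y))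
      (mcomp (2 * vertices u + 3) ?A (mcomp (2 * vertices v + 1) (qtree v) (qtree y)))"
    by (rule veq_assoc[OF A vin_qtree vin_qtree]) auto
  also have "veq ?N \<dots> (mcomp (2 * vertices u + 3) ?A (qtree (under v y)))"
    using veq_right[OF Node.IH(2) A, of "2 * vertices u + 3"] by (simp add: algebra_simps)
  finally show ?case
    using veq_cmul[of ?N _ _ "(- 1) ^ vertices u"] by (simp add: algebra_simps)
qed

text \<open>Composition at the first input descends the left branch of \<open>w\<close>: commutation
  takes \<open>qtree x\<close> past \<open>qtree v\<close>, associativity moves it into
  \<open>qtree u\<close>.\<close>

lemma qtree_over:
  "veq (vertices x + vertices w) (mcomp 1 (qtree w) (qtree x))
     (frag_cmul ((- 1) ^ (vertices x * vertices w)) (qtree (over x w)))"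
proof (induction w)
  case Leaf
  show ?case using veq_unit_left[OF vin_qtree[of x]] by simp
next
  case (Node u v)
  let ?A = "mcomp 1 gen (qtree u)" and ?N = "vertices x + vertices u + 1 + vertices v"
  let ?k = "2 * vertices u + 2 * vertices x + 3"
  have A: "vin (vertices u + 1) ?A" by (rule vin_gen_qtree[OF vin_qtree])
  have "veq (1 + vertices u + vertices x) (mcomp 1 ?A (qtree x)) (mcomp 1 gen (mcomp 1 (qtree u) (qtree x)))"
    by (rule veq_assoc[OF vin_gen vin_qtree vin_qtree]) auto
  also have "veq (1 + vertices u + vertices x) \<dots>
      (mcomp 1 gen (frag_cmul ((- 1) ^ (vertices x * vertices u)) (qtree (over x u))))"
    using veq_right[OF Node.IH(1) vin_gen, of 1] by (simp add: algebra_simps)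
  finally have "veq (vertices u + 1 + vertices x) (mcomp 1 ?A (qtree x))
      (frag_cmul ((- 1) ^ (vertices x * vertices u)) (mcomp 1 gen (qtree (over x u))))"
    by (simp add: algebra_simps)
  from veq_left[OF this vin_qtree[of v], of ?k]
  have 1: "veq ?N (mcomp ?k (mcomp 1 ?A (qtree x)) (qtree v))
      (frag_cmul ((- 1) ^ (vertices x * vertices u)) (mcomp ?k (mcomp 1 gen (qtree (over x u))) (qtree v)))"
    by (simp add: algebra_simps)
  have "veq ?N (mcomp ?k (mcomp 1 ?A (qtree x)) (qtree v))
      (frag_cmul ((- 1) ^ (vertices x * vertices v)) (mcomp 1 (mcomp (2 * vertices u + 3) ?A (qtree v)) (qtree x)))"
    by (rule veq_commute[OF A vin_qtree vin_qtree]) auto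
  \<comment> \<open>The extra factor clears the Koszul sign on the left and leaves the normalising
    sign of \<open>qtree (Node u v)\<close>.\<close>
  from veq_trans[OF veq_sym[OF this] 1]
  have "veq ?N (frag_cmul ((- 1) ^ (vertices x * vertices v + vertices u)) (frag_cmul ((- 1) ^ (vertices x * vertices v))
          (mcomp 1 (mcomp (2 * vertices u + 3) ?A (qtree v)) (qtree x))))
      (frag_cmul ((- 1) ^ (vertices x * vertices v + vertices u)) (frag_cmul ((- 1) ^ (vertices x * vertices u))
         (mcomp ?k (mcomp 1 gen (qtree (over x u))) (qtree v))))"
    by (rule veq_cmul)
  moreover have "(- 1 :: int) ^ (vertices x * vertices v + vertices u) * (- 1) ^ (vertices x * vertices v) = (- 1) ^ vertices u"
    "(- 1 :: int) ^ (vertices x * vertices v + vertices u) * (- 1) ^ (vertices x * vertices u)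
     = (- 1) ^ (vertices x * vertices (Node u v)) * (- 1) ^ vertices (over x u)"
    by (cases "even (vertices x)"; cases "even (vertices v)"; cases "even (vertices u)"; simp)+
  ultimately show ?case
    by (simp add: algebra_simps)
qed

lemma qfrag_under:
  assumes "Poly_Mapping.keys f \<subseteq> Y m" "Poly_Mapping.keys g \<subseteq> Y n"
  shows "veq (m + n) (mcomp (2 * m + 1) (qfrag f) (qfrag g)) (qfrag (frag_under f g))"
  using assms
proof (rule bil_ind)
  fix x y assume "x \<in> Y m" "y \<in> Y n"
  then show "veq (m + n) (mcomp (2 * m + 1) (qfrag (frag_of x)) (qfrag (frag_of y)))
      (qfrag (frag_under (frag_of x) (frag_of y)))"
    using qtree_under[of x y] by (simp add: Y_def)
qed (auto simp: mcomp_simps intro: veq_diff)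

lemma qfrag_over:
  assumes "Poly_Mapping.keys f \<subseteq> Y m" "Poly_Mapping.keys g \<subseteq> Y n"
  shows "veq (m + n) (mcomp 1 (qfrag g) (qfrag f)) (frag_cmul ((- 1) ^ (m * n)) (qfrag (frag_over f g)))"
  using assms
proof (rule bil_ind)
  fix x y assume "x \<in> Y m" "y \<in> Y n"
  then show "veq (m + n) (mcomp 1 (qfrag (frag_of y)) (qfrag (frag_of x)))
      (frag_cmul ((- 1) ^ (m * n)) (qfrag (frag_over (frag_of x) (frag_of y))))"
    using qtree_over[of x y] by (simp add: Y_def)
qed (auto simp: mcomp_simps frag_cmul_diff2 intro: veq_diff)

lemma veq_gen: "veq 1 gen (qtree (Node Leaf Leaf))"
proof -
  have 1: "veq 1 (mcomp 1 gen unit) gen" by (rule veq_unit_right) (use vin_gen in auto)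
  have "veq 1 (mcomp 3 (mcomp 1 gen unit) unit) (mcomp 1 gen unit)"
    by (rule veq_unit_right) (use vin_gen_qtree[OF vin_unit] in auto)
  from veq_sym[OF veq_trans[OF this 1]] show ?thesis by simp
qed

text \<open>\<open>Q_(a,b)\<close> starts with \<open>g\<close>, so grafting it into the middle of
  \<open>g\<close> produces \<open>g \<circ>\<^sub>2 g\<close>. The relation gives two terms, which
  rearrange to compositions of \<open>g \<circ>\<^sub>2 Q_a\<close> and
  \<open>g \<circ>\<^sub>2 Q_b\<close> at the first and at the last input.\<close>

lemma mcomp_2_gen_qtree: "veq (vertices y + 1) (mcomp 2 gen (qtree y)) (qfrag (\<gamma> y))"
proof (induction y)
  case Leaf
  have "veq 1 (mcomp 2 gen unit) gen" by (rule veq_unit_right) (use vin_gen in auto)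
  from veq_trans[OF this veq_gen] show ?case by simp
next
  case (Node a b)
  let ?m = "vertices a" and ?n = "vertices b"
  let ?ca = "mcomp 2 gen (qtree a)" and ?cb = "mcomp 2 gen (qtree b)"
  let ?A = "mcomp 1 gen (qtree a)" and ?N = "?m + 1 + (?n + 1)"
  have A: "vin (?m + 1) ?A" by (rule vin_gen_qtree[OF vin_qtree])
  have ca: "vin (?m + 1) ?ca" and cb: "vin (?n + 1) ?cb"
    using vin_mcomp[OF vin_gen vin_qtree, of 2] by (simp_all add: add.commute)
  note keys = \<gamma>_keys[of a] \<gamma>_keys[of b]

  \<comment> \<open>First without \<open>qtree b\<close>: associativity exposes
    \<open>g \<circ>\<^sub>2 g\<close>, the relation splits it, and commutation puts the
    \<open>g \<circ>\<^sub>3 g\<close> term into the form of \<open>?ca\<close> followed by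
    \<open>gen\<close> at its last input.\<close>
  have "veq (?m + 2) (mcomp 2 gen ?A) (mcomp 2 (mcomp 2 gen gen) (qtree a))"
    by (rule veq_sym, rule veq_assoc[OF vin_gen vin_gen vin_qtree]) auto
  also have "veq (?m + 2) \<dots> (mcomp 2 (mcomp 1 gen gen + mcomp 3 gen gen) (qtree a))"
    using veq_left[OF veq_relation vin_qtree[of a], of 2] by (simp add: algebra_simps)
  also have "\<dots> = mcomp 2 (mcomp 1 gen gen) (qtree a) + mcomp 2 (mcomp 3 gen gen) (qtree a)"
    by (simp add: mcomp_simps)
  also have "veq (?m + 2) \<dots> (mcomp 1 gen ?ca + frag_cmul ((- 1) ^ ?m) (mcomp (2 * ?m + 3) ?ca gen))"
  proof (rule veq_add)
    show "veq (?m + 2) (mcomp 2 (mcomp 1 gen gen) (qtree a)) (mcomp 1 gen ?ca)"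
      by (rule veq_assoc[OF vin_gen vin_gen vin_qtree]) auto
    have "veq (?m + 2) (mcomp (2 * ?m + 3) ?ca gen)
        (frag_cmul ((- 1) ^ (?m * 1)) (mcomp 2 (mcomp 3 gen gen) (qtree a)))"
      by (rule veq_commute[OF vin_gen vin_qtree vin_gen]) auto
    from veq_sym[OF veq_cmul[OF this, of "(- 1) ^ ?m"]]
    show "veq (?m + 2) (mcomp 2 (mcomp 3 gen gen) (qtree a)) (frag_cmul ((- 1) ^ ?m) (mcomp (2 * ?m + 3) ?ca gen))"
      by (simp flip: power_add mult_2)
  qed
  finally have 1: "veq (?m + 2) (mcomp 2 gen ?A)
      (mcomp 1 gen ?ca + frag_cmul ((- 1) ^ ?m) (mcomp (2 * ?m + 3) ?ca gen))" .

  \<comment> \<open>Place \<open>2 * ?m + 4\<close> is the last input of \<open>?A\<close> seen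
    inside \<open>mcomp 2 gen ?A\<close>.\<close>
  have "veq ?N (mcomp 2 gen (mcomp (2 * ?m + 3) ?A (qtree b))) (mcomp (2 * ?m + 4) (mcomp 2 gen ?A) (qtree b))"
    by (rule veq_sym, rule veq_assoc[OF vin_gen A vin_qtree]) auto
  also have "veq ?N \<dots> (mcomp (2 * ?m + 4) (mcomp 1 gen ?ca + frag_cmul ((- 1) ^ ?m) (mcomp (2 * ?m + 3) ?ca gen)) (qtree b))"
    using veq_left[OF 1 vin_qtree[of b], of "2 * ?m + 4"] by (simp add: algebra_simps)
  also have "\<dots> = mcomp (2 * ?m + 4) (mcomp 1 gen ?ca) (qtree b)
      + frag_cmul ((- 1) ^ ?m) (mcomp (2 * ?m + 4) (mcomp (2 * ?m + 3) ?ca gen) (qtree b))"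
    by (simp add: mcomp_simps)
  \<comment> \<open>In the first term \<open>qtree b\<close> sits at the middle input of the outer
    \<open>gen\<close>, in the second at that of the \<open>gen\<close> grafted onto
    \<open>?ca\<close>; either way \<open>?cb\<close> appears.\<close>
  also have "veq ?N \<dots> (frag_cmul ((- 1) ^ ((?m + 1) * ?n)) (mcomp 1 ?cb ?ca)
      + frag_cmul ((- 1) ^ ?m) (mcomp (2 * ?m + 3) ?ca ?cb))"
    by (intro veq_add veq_cmul veq_commute[OF vin_gen ca vin_qtree] veq_assoc[OF ca vin_gen vin_qtree]) auto
  also have "veq ?N \<dots> (frag_cmul ((- 1) ^ ((?m + 1) * ?n)) (frag_cmul ((- 1) ^ ((?m + 1) * (?n + 1))) (qfrag (frag_over (\<gamma> a) (\<gamma> b))))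
      + frag_cmul ((- 1) ^ ?m) (qfrag (frag_under (\<gamma> a) (\<gamma> b))))"
  proof (intro veq_add veq_cmul)
    have "veq ?N (mcomp 1 ?cb ?ca) (mcomp 1 ?cb (qfrag (\<gamma> a)))"
      using veq_right[OF Node.IH(1) cb, of 1] by (simp add: algebra_simps)
    also have "veq ?N \<dots> (mcomp 1 (qfrag (\<gamma> b)) (qfrag (\<gamma> a)))"
      using veq_left[OF Node.IH(2) vin_qfrag[OF keys(1)], of 1] by (simp add: algebra_simps)
    also have "veq ?N \<dots> (frag_cmul ((- 1) ^ ((?m + 1) * (?n + 1))) (qfrag (frag_over (\<gamma> a) (\<gamma> b))))"
      by (rule qfrag_over[OF keys])
    finally show "veq ?N (mcomp 1 ?cb ?ca) \<dots>" .
    have "veq ?N (mcomp (2 * ?m + 3) ?ca ?cb) (mcomp (2 * ?m + 3) ?ca (qfrag (\<gamma> b)))"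
      using veq_right[OF Node.IH(2) ca, of "2 * ?m + 3"] by simp
    also have "veq ?N \<dots> (mcomp (2 * ?m + 3) (qfrag (\<gamma> a)) (qfrag (\<gamma> b)))"
      using veq_left[OF Node.IH(1) vin_qfrag[OF keys(2)], of "2 * ?m + 3"] by simp
    also have "veq ?N \<dots> (qfrag (frag_under (\<gamma> a) (\<gamma> b)))"
      using qfrag_under[OF keys] by (simp add: numeral_3_eq_3)
    finally show "veq ?N (mcomp (2 * ?m + 3) ?ca ?cb) \<dots>" .
  qed
  finally have "veq ?N (frag_cmul ((- 1) ^ ?m) (mcomp 2 gen (mcomp (2 * ?m + 3) ?A (qtree b))))
    (frag_cmul ((- 1) ^ ?m) (frag_cmul ((- 1) ^ ((?m + 1) * ?n)) (frag_cmul ((- 1) ^ ((?m + 1) * (?n + 1))) (qfrag (frag_over (\<gamma> a) (\<gamma> b))))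
      + frag_cmul ((- 1) ^ ?m) (qfrag (frag_under (\<gamma> a) (\<gamma> b)))))"
    by (rule veq_cmul)
  \<comment> \<open>The signs collapse to -1 on the \<open>over\<close> term and to 1 on the
    \<open>under\<close> term, as in the recursion of \<open>\<gamma>\<close>.\<close>
  moreover have "(- 1 :: int) ^ ?m * ((- 1) ^ ((?m + 1) * ?n) * (- 1) ^ ((?m + 1) * (?n + 1))) = - 1"
    "(- 1 :: int) ^ ?m * (- 1) ^ ?m = 1"
    by (cases "even ?m"; cases "even ?n"; simp)+
  ultimately show ?case
    by (simp add: frag_cmul_distrib2 algebra_simps del: power_Suc)
qed

text \<open>The form in which \<open>\<gamma>\<close> enters the computation of theta: place
  \<open>2 * m + 2\<close> is the middle input of the \<open>gen\<close> grafted at the last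
  input.\<close>

lemma mcomp_max_\<gamma>:
  assumes "Poly_Mapping.keys f \<subseteq> Y m"
  shows "veq (m + vertices y + 1) (mcomp (2 * m + 2) (mcomp (2 * m + 1) (qfrag f) gen) (qtree y)) (qfrag (frag_under f (\<gamma> y)))"
proof -
  let ?N = "m + vertices y + 1"
  note f = vin_qfrag[OF assms]
  have "veq ?N (mcomp (2 * m + 2) (mcomp (2 * m + 1) (qfrag f) gen) (qtree y)) (mcomp (2 * m + 1) (qfrag f) (mcomp 2 gen (qtree y)))"
    by (rule veq_assoc[OF f vin_gen vin_qtree]) auto
  also have "veq ?N \<dots> (mcomp (2 * m + 1) (qfrag f) (qfrag (\<gamma> y)))"
    using veq_right[OF mcomp_2_gen_qtree f, of "2 * m + 1"] by (simp add: algebra_simps)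
  also have "veq ?N \<dots> (qfrag (frag_under f (\<gamma> y)))"
    using qfrag_under[OF assms \<gamma>_keys[of y]] by (simp add: algebra_simps)
  finally show ?thesis .
qed

section \<open>The elements \<open>Q\<^sub>x\<close> span \<open>V\<close>\<close>

definition qspan :: "nat \<Rightarrow> (opmono \<Rightarrow>\<^sub>0 int) \<Rightarrow> bool" where
  "qspan n a \<longleftrightarrow> (\<exists>f. Poly_Mapping.keys f \<subseteq> Y n \<and> veq n a (qfrag f))"

lemma qspan_qfrag: "Poly_Mapping.keys f \<subseteq> Y n \<Longrightarrow> qspan n (qfrag f)"
  unfolding qspan_def by (blast intro: veq_refl)

lemma qspan_qtree: "qspan (vertices x) (qtree x)"
  using qspan_qfrag[of "frag_of x"] by (simp add: Y_def)

lemma qspan_veq: "veq n a b \<Longrightarrow> qspan n b \<Longrightarrow> qspan n a"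
  unfolding qspan_def by (blast intro: veq_trans)

lemma qspan_0: "qspan n 0"
  using qspan_qfrag[of 0 n] by simp

lemma qspan_diff:
  assumes "qspan n a" "qspan n b"
  shows "qspan n (a - b)"
proof -
  from assms obtain f g where fg: "Poly_Mapping.keys f \<subseteq> Y n" "Poly_Mapping.keys g \<subseteq> Y n"
    and "veq n a (qfrag f)" "veq n b (qfrag g)" unfolding qspan_def by blast
  then have "veq n (a - b) (qfrag (f - g))" unfolding qfrag_simps by (intro veq_diff)
  then show ?thesis using keys_diffI[OF fg] unfolding qspan_def by blast
qed

lemma qspan_cmul: "qspan n a \<Longrightarrow> qspan n (frag_cmul k a)"
  by (rule frag_closure_minus_cmul) (auto intro: qspan_0 qspan_diff)

text \<open>A sign is its own inverse, so a commutation can be used backwards.\<close>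

lemma qspan_sign:
  assumes "veq n a (frag_cmul ((- 1) ^ k) b)" "qspan n a"
  shows "qspan n b"
proof -
  have "veq n (frag_cmul ((- 1) ^ k) a) b"
    using veq_cmul[OF assms(1), of "(- 1) ^ k"] by (simp flip: power_add mult_2)
  from qspan_veq[OF veq_sym[OF this] qspan_cmul[OF assms(2)]] show ?thesis .
qed

lemma qspan_max:
  assumes "qspan m a" "qspan n b" "vin m a" "vin n b"
  shows "qspan (m + n) (mcomp (2 * m + 1) a b)"
proof -
  from assms obtain f g where f: "Poly_Mapping.keys f \<subseteq> Y m" "veq m a (qfrag f)"
    and g: "Poly_Mapping.keys g \<subseteq> Y n" "veq n b (qfrag g)" unfolding qspan_def by blast
  have "veq (m + n) (mcomp (2 * m + 1) a b) (mcomp (2 * m + 1) (qfrag f) b)"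
    using f(2) assms(4) by (rule veq_left) auto
  also have "veq (m + n) \<dots> (mcomp (2 * m + 1) (qfrag f) (qfrag g))"
    using g(2) vin_qfrag[OF f(1)] by (rule veq_right) auto
  also have "veq (m + n) \<dots> (qfrag (frag_under f g))"
    by (rule qfrag_under[OF f(1) g(1)])
  finally have "veq (m + n) (mcomp (2 * m + 1) a b) (qfrag (frag_under f g))" .
  moreover have "Poly_Mapping.keys (frag_under f g) \<subseteq> Y (m + n)"
    using f(1) g(1) by (rule bil_keys) (auto simp: Y_def)
  ultimately show ?thesis unfolding qspan_def by blast
qed

lemma qspan_min:
  assumes "qspan m a" "qspan n b" "vin m a" "vin n b"
  shows "qspan (m + n) (mcomp 1 b a)"
proof -
  from assms obtain f g where f: "Poly_Mapping.keys f \<subseteq> Y m" "veq m a (qfrag f)"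
    and g: "Poly_Mapping.keys g \<subseteq> Y n" "veq n b (qfrag g)" unfolding qspan_def by blast
  have "veq (n + m) (mcomp 1 b a) (mcomp 1 (qfrag g) a)"
    using g(2) assms(3) by (rule veq_left) auto
  also have "veq (n + m) \<dots> (mcomp 1 (qfrag g) (qfrag f))"
    using f(2) vin_qfrag[OF g(1)] by (rule veq_right) auto
  also have "veq (n + m) \<dots> (frag_cmul ((- 1) ^ (m * n)) (qfrag (frag_over f g)))"
    using qfrag_over[OF f(1) g(1)] by (simp add: add.commute)
  finally have "veq (m + n) (mcomp 1 b a) (frag_cmul ((- 1) ^ (m * n)) (qfrag (frag_over f g)))"
    by (simp add: add.commute)
  moreover have "Poly_Mapping.keys (frag_over f g) \<subseteq> Y (m + n)"
    using f(1) g(1) by (rule bil_keys) (auto simp: Y_def)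
  ultimately show ?thesis using qspan_veq[OF _ qspan_cmul[OF qspan_qfrag]] by blast
qed

section \<open>Closure under composition at every place\<close>

lemma qspan_gen: "qspan 1 gen"
  using qspan_veq[OF veq_gen] qspan_qtree[of "Node Leaf Leaf"] by simp

text \<open>The place \<open>i\<close> falls inside \<open>u\<close>, at the middle input of the
  root, or inside \<open>v\<close>. The middle input is where the relation enters, through
  \<open>mcomp_2_gen_qtree\<close>.\<close>

lemma qspan_mcomp_qtree:
  assumes "1 \<le> i" "i \<le> 2 * vertices w + 1"
  shows "qspan (vertices w + vertices x) (mcomp i (qtree w) (qtree x))"
  using assms
proof (induction w arbitrary: i)
  case Leaf
  then have "i = 1" by simp
  then show ?case using qspan_veq[OF veq_unit_left[OF vin_qtree] qspan_qtree, of x] by simp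
next
  case (Node u v)
  let ?A = "mcomp 1 gen (qtree u)" and ?N = "vertices u + 1 + vertices v + vertices x"
  have A: "vin (vertices u + 1) ?A" by (rule vin_gen_qtree[OF vin_qtree])
  have sA: "qspan (vertices u + 1) ?A"
    by (rule qspan_min[OF qspan_qtree qspan_gen vin_qtree vin_gen])
  have "qspan ?N (mcomp i (mcomp (2 * vertices u + 3) ?A (qtree v)) (qtree x))"
  proof (cases "i \<le> 2 * vertices u + 2")
    \<comment> \<open>The place lies to the left of \<open>v\<close>: \<open>?A\<close> is composed
      with \<open>qtree x\<close> first, and \<open>qtree v\<close> is attached afterwards at the
      last input.\<close>
    case True
    have *: "qspan (vertices u + 1 + vertices x) (mcomp i ?A (qtree x))"
    proof (cases "i = 2 * vertices u + 2")
      \<comment> \<open>At the middle input of the root, exchanging \<open>qtree u\<close> and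
        \<open>qtree x\<close> exposes \<open>mcomp 2 gen (qtree x)\<close>.\<close>
      case True
      have "veq (1 + vertices u + vertices x) (mcomp (2 * vertices u + 2) ?A (qtree x))
          (frag_cmul ((- 1) ^ (vertices u * vertices x)) (mcomp 1 (mcomp 2 gen (qtree x)) (qtree u)))"
        by (rule veq_commute[OF vin_gen vin_qtree vin_qtree]) auto
      moreover have c: "qspan (vertices x + 1) (mcomp 2 gen (qtree x))"
        by (rule qspan_veq[OF mcomp_2_gen_qtree qspan_qfrag[OF \<gamma>_keys]])
      moreover have "vin (vertices x + 1) (mcomp 2 gen (qtree x))"
        using vin_mcomp[OF vin_gen vin_qtree, of 2 x] by (simp add: add.commute)
      then have "qspan (1 + vertices u + vertices x) (mcomp 1 (mcomp 2 gen (qtree x)) (qtree u))"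
        using qspan_min[OF qspan_qtree c vin_qtree, of u] by (simp add: algebra_simps)
      ultimately show ?thesis
        using qspan_veq[OF _ qspan_cmul] True by (simp add: add.commute)
    next
      case False
      with True have i: "i \<le> 2 * vertices u + 1" by simp
      have "veq (1 + vertices u + vertices x) (mcomp i ?A (qtree x)) (mcomp 1 gen (mcomp i (qtree u) (qtree x)))"
        by (rule veq_assoc[OF vin_gen vin_qtree vin_qtree]) (use i Node.prems in auto)
      moreover have "qspan (vertices u + vertices x + 1) (mcomp 1 gen (mcomp i (qtree u) (qtree x)))"
        by (intro qspan_min Node.IH qspan_gen vin_gen vin_mcomp vin_qtree i Node.prems)
      then have "qspan (1 + vertices u + vertices x) (mcomp 1 gen (mcomp i (qtree u) (qtree x)))"
        by (simp add: algebra_simps)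
      ultimately have "qspan (1 + vertices u + vertices x) (mcomp i ?A (qtree x))" by (rule qspan_veq)
      then show ?thesis by (simp add: algebra_simps)
    qed
    have "veq ?N (mcomp (2 * vertices u + 3 + 2 * vertices x) (mcomp i ?A (qtree x)) (qtree v))
        (frag_cmul ((- 1) ^ (vertices x * vertices v)) (mcomp i (mcomp (2 * vertices u + 3) ?A (qtree v)) (qtree x)))"
      by (rule veq_commute[OF A vin_qtree vin_qtree]) (use True Node.prems in auto)
    moreover have "qspan ?N (mcomp (2 * (vertices u + 1 + vertices x) + 1) (mcomp i ?A (qtree x)) (qtree v))"
      using qspan_max[OF * qspan_qtree vin_mcomp[OF A vin_qtree] vin_qtree, of v] True Node.prems
      by (simp add: algebra_simps)
    moreover have "2 * (vertices u + 1 + vertices x) + 1 = 2 * vertices u + 3 + 2 * vertices x" by simp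
    ultimately show ?thesis using qspan_sign by metis
  next
    case False
    \<comment> \<open>\<open>?A\<close> has \<open>2 * vertices u + 2\<close> inputs before its last
      one, so \<open>j\<close> is the place counted inside \<open>v\<close>.\<close>
    define j where "j = i - (2 * vertices u + 2)"
    have j: "1 \<le> j" "j \<le> 2 * vertices v + 1" "i = j + (2 * vertices u + 3) - 1"
      using False Node.prems by (auto simp: j_def)
    have "veq ?N (mcomp i (mcomp (2 * vertices u + 3) ?A (qtree v)) (qtree x))
        (mcomp (2 * vertices u + 3) ?A (mcomp j (qtree v) (qtree x)))"
      by (rule veq_assoc[OF A vin_qtree vin_qtree]) (use j in auto)
    moreover have "qspan (vertices u + 1 + (vertices v + vertices x))
        (mcomp (2 * (vertices u + 1) + 1) ?A (mcomp j (qtree v) (qtree x)))"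
      by (intro qspan_max sA A Node.IH vin_mcomp vin_qtree j)
    moreover have "2 * (vertices u + 1) + 1 = 2 * vertices u + 3"
      "vertices u + 1 + (vertices v + vertices x) = ?N" by simp_all
    ultimately show ?thesis using qspan_veq by metis
  qed
  then show ?case
    using qspan_cmul[of ?N _ "(- 1) ^ vertices u"] by (simp add: algebra_simps)
qed

lemma qspan_mcomp:
  assumes ab: "qspan m a" "qspan n b" "vin m a" "vin n b" and i: "1 \<le> i" "i \<le> 2 * m + 1"
  shows "qspan (m + n) (mcomp i a b)"
proof -
  from ab obtain f g where f: "Poly_Mapping.keys f \<subseteq> Y m" "veq m a (qfrag f)"
    and g: "Poly_Mapping.keys g \<subseteq> Y n" "veq n b (qfrag g)" unfolding qspan_def by blast
  have "veq (m + n) (mcomp i a b) (mcomp i (qfrag f) b)"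
    by (rule veq_left[OF f(2) ab(4) i])
  also have "veq (m + n) \<dots> (mcomp i (qfrag f) (qfrag g))"
    by (rule veq_right[OF g(2) vin_qfrag[OF f(1)] i])
  finally have "veq (m + n) (mcomp i a b) (mcomp i (qfrag f) (qfrag g))" .
  moreover have "qspan (m + n) (mcomp i (qfrag f) (qfrag g))"
    using f(1) g(1)
  proof (rule bil_ind)
    fix x y assume "x \<in> Y m" "y \<in> Y n"
    then show "qspan (m + n) (mcomp i (qfrag (frag_of x)) (qfrag (frag_of y)))"
      using qspan_mcomp_qtree[of i x y] i by (simp add: Y_def)
  qed (auto simp: mcomp_simps intro: qspan_0 qspan_diff)
  ultimately show ?thesis by (rule qspan_veq)
qed

lemma mdeg_odd: "mvalid t \<Longrightarrow> \<exists>n. mdeg t = 2 * n + 1"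
proof -
  assume "mvalid t"
  then have "odd (int (mdeg t))" by (simp add: mdeg_mwt)
  then show ?thesis by (auto elim: oddE)
qed

lemma qspan_frag_of: "mvalid t \<Longrightarrow> mdeg t = 2 * n + 1 \<Longrightarrow> qspan n (frag_of t)"
proof (induction t arbitrary: n)
  case MUnit
  then show ?case using qspan_qtree[of Leaf] by simp
next
  case MGen
  then show ?case using qspan_gen by simp
next
  case (MComp s i t)
  then obtain p q where d: "mdeg s = 2 * p + 1" "mdeg t = 2 * q + 1"
    using mdeg_odd[of s] mdeg_odd[of t] by auto
  with MComp have "qspan (p + q) (mcomp i (frag_of s) (frag_of t))"
    by (intro qspan_mcomp MComp.IH) (auto simp: opmonos_def)
  moreover have "n = p + q" using MComp.prems d by simp
  ultimately show ?case by (simp add: mcomp_simps)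
qed

lemma V_spanned:
  assumes "v \<in> carrier (op_grp V_operad (2 * n + 1))"
  obtains f where "Poly_Mapping.keys f \<subseteq> Y n" "v = vcls (2 * n + 1) (qfrag f)"
proof -
  from assms obtain a where a: "v = vcls (2 * n + 1) a" "vin n a" by (auto simp: carrier_V)
  from a(2) have "qspan n a"
  proof (induction a rule: frag_induct)
    case (single t)
    then show ?case using qspan_frag_of[of t n] by (simp add: opmonos_def)
  qed (simp_all add: qspan_0 qspan_diff)
  then obtain f where "Poly_Mapping.keys f \<subseteq> Y n" "veq n a (qfrag f)" unfolding qspan_def by blast
  then show ?thesis using that a(1) vcls_eq_veq[of n a "qfrag f"] by blast
qed


section \<open>The anticyclic operator on \<open>Q\<^sub>x\<close>\<close>

lemma V_inv:
  assumes "Poly_Mapping.keys a \<subseteq> opmonos n"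
  shows "inv\<^bsub>op_grp V_operad n\<^esub> vcls n a = vcls n (- a)"
proof -
  interpret G: comm_group "op_grp V_operad n" by (rule comm_group_V)
  have "vcls n a \<in> carrier (op_grp V_operad n)" using assms by (simp add: carrier_V)
  then show ?thesis using vcls_int_pow[OF assms, of "-1"] by (simp add: G.int_pow_neg)
qed

lemma vcls_in_wt: "vin n a \<Longrightarrow> vcls (2 * n + 1) a \<in> op_wt V_operad (2 * n + 1) (int n)"
  by (simp add: op_wt_V carrier_V)

text \<open>Up to sign \<open>Q_(x,y)\<close> is \<open>g \<circ>\<^sub>1 Q_x\<close> with
  \<open>Q_y\<close> at its last input. The axiom for the first place turns
  \<open>g \<circ>\<^sub>1 Q_x\<close> into \<open>\<theta>(Q_x)\<close> followed by
  \<open>\<theta>(g)\<close> at its last input; the axiom for later places then moves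
  \<open>Q_y\<close> into the middle of that \<open>g\<close>.\<close>

lemma theta_V_Q:
  assumes "anticyclic_operad V_operad theta"
    and theta_gen: "theta 3 V_gen = inv\<^bsub>op_grp V_operad 3\<^esub> V_gen"
  shows "theta (2 * vertices x + 1) (Q x) = vcls (2 * vertices x + 1) (- qfrag (\<rho> x))"
proof -
  interpret anticyclic_operad V_operad theta by fact
  have g3: "Poly_Mapping.keys gen \<subseteq> opmonos 3" using vin_gen by simp
  have "theta (2 * vertices x + 1) (vcls (2 * vertices x + 1) (qtree x)) =
    vcls (2 * vertices x + 1) (- qfrag (\<rho> x))"
  proof (induction x)
    case Leaf
    show ?case
      using theta_unit V_inv[of unit 1] vin_unit by (simp add: V_operad_def)
  next
    case (Node x y)
    define p where "p = vertices x"
    define q where "q = vertices y"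
    let ?A = "mcomp 1 gen (qtree x)" and ?B = "mcomp (2 * p + 1) (qfrag (\<rho> x)) gen"
    have x: "vin p (qtree x)" and y: "vin q (qtree y)" unfolding p_def q_def by (rule vin_qtree)+
    have r: "vin p (qfrag (\<rho> x))" unfolding p_def by (rule vin_qfrag[OF \<rho>_keys])
    have A: "vin (p + 1) ?A" by (rule vin_gen_qtree[OF x])
    have B: "vin (p + 1) ?B" using vin_mcomp[OF r vin_gen] by simp
    have d: "3 + (2 * p + 1) - 1 = 2 * (p + 1) + 1" "2 * p + 1 + 3 - 1 = 2 * (p + 1) + 1"
      "2 * (p + 1) + 1 + (2 * q + 1) - 1 = 2 * (p + 1 + q) + 1" "2 * (p + 1) + 1 - 1 = 2 * p + 2"
      by simp_all
    have "theta (2 * (p + 1) + 1) (op_comp V_operad 3 (2 * p + 1) 1 V_gen (vcls (2 * p + 1) (qtree x))) =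
      op_comp V_operad (2 * p + 1) 3 (2 * p + 1) (theta (2 * p + 1) (vcls (2 * p + 1) (qtree x))) (theta 3 V_gen)
        [^]\<^bsub>op_grp V_operad (2 * (p + 1) + 1)\<^esub> (- ksgn (1 * int p))"
      using theta_comp_1[of 3 "2 * p + 1" V_gen 1 "vcls (2 * p + 1) (qtree x)" "int p"]
        vcls_in_wt[OF x] vcls_in_wt[OF vin_gen] unfolding V_gen_def d by simp
    \<comment> \<open>The minus signs of \<open>\<theta>(Q_x)\<close> and \<open>\<theta>(g)\<close>
      cancel.\<close>
    also have "op_comp V_operad (2 * p + 1) 3 (2 * p + 1) (theta (2 * p + 1) (vcls (2 * p + 1) (qtree x))) (theta 3 V_gen)
        = vcls (2 * (p + 1) + 1) ?B"
      using op_comp_vcls[of "- qfrag (\<rho> x)" "2 * p + 1" "- gen" 3 "2 * p + 1"] r g3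
      unfolding theta_gen[unfolded V_gen_def] V_gen_def V_inv[OF g3] Node.IH(1)[folded p_def] d by simp
    also have "\<dots> [^]\<^bsub>op_grp V_operad (2 * (p + 1) + 1)\<^esub> (- ksgn (1 * int p))
        = vcls (2 * (p + 1) + 1) (frag_cmul (- ((- 1) ^ p)) ?B)"
      using vcls_int_pow[OF B] by (simp add: ksgn_int)
    also have "op_comp V_operad 3 (2 * p + 1) 1 V_gen (vcls (2 * p + 1) (qtree x)) = vcls (2 * (p + 1) + 1) ?A"
      using op_comp_vcls[OF g3 x, of 1] unfolding V_gen_def d by simp
    finally have 1: "theta (2 * (p + 1) + 1) (vcls (2 * (p + 1) + 1) ?A) =
      vcls (2 * (p + 1) + 1) (frag_cmul (- ((- 1) ^ p)) ?B)" .
    let ?C = "mcomp (2 * p + 3) ?A (qtree y)" and ?N = "p + 1 + q"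
    have C: "vin ?N ?C" using vin_mcomp[OF A y, of "2 * p + 3"] by simp
    have carr: "vcls (2 * n + 1) a \<in> carrier (op_grp V_operad (2 * n + 1))" if "vin n a" for n a
      using that by (simp add: carrier_V)
    \<comment> \<open>The last place \<open>2 * p + 3\<close> exceeds 1, so theta lowers it to
      \<open>2 * p + 2\<close>, the middle input of the \<open>gen\<close> in
      \<open>?B\<close>.\<close>
    have "theta (2 * ?N + 1) (op_comp V_operad (2 * (p + 1) + 1) (2 * q + 1) (2 * (p + 1) + 1)
        (vcls (2 * (p + 1) + 1) ?A) (vcls (2 * q + 1) (qtree y))) =
      op_comp V_operad (2 * (p + 1) + 1) (2 * q + 1) (2 * p + 2)
        (vcls (2 * (p + 1) + 1) (frag_cmul (- ((- 1) ^ p)) ?B)) (vcls (2 * q + 1) (qtree y))"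
      using theta_comp[OF _ _ _ _ carr[OF A] carr[OF y], of "2 * (p + 1) + 1"] unfolding d 1 by simp
    also have "\<dots> = vcls (2 * ?N + 1) (mcomp (2 * p + 2) (frag_cmul (- ((- 1) ^ p)) ?B) (qtree y))"
      using op_comp_vcls[OF keys_cmulI[OF B] y, of "2 * p + 2"] unfolding d by simp
    also have "op_comp V_operad (2 * (p + 1) + 1) (2 * q + 1) (2 * (p + 1) + 1)
        (vcls (2 * (p + 1) + 1) ?A) (vcls (2 * q + 1) (qtree y)) = vcls (2 * ?N + 1) ?C"
      using op_comp_vcls[OF A y, of "2 * (p + 1) + 1"] unfolding d by (simp add: numeral_3_eq_3)
    finally have 2: "theta (2 * ?N + 1) (vcls (2 * ?N + 1) ?C) =
      vcls (2 * ?N + 1) (frag_cmul (- ((- 1) ^ p)) (mcomp (2 * p + 2) ?B (qtree y)))"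
      by simp
    interpret T: group_hom "op_grp V_operad (2 * ?N + 1)" "op_grp V_operad (2 * ?N + 1)" "theta (2 * ?N + 1)"
      using comm_group_V theta_hom[of "2 * ?N + 1"]
      by (intro group_hom.intro group_hom_axioms.intro) (auto simp: comm_group_def)
    have D: "vin ?N (mcomp (2 * p + 2) ?B (qtree y))"
      using vin_mcomp[OF B y, of "2 * p + 2"] by simp
    \<comment> \<open>The normalising sign of \<open>qtree (Node x y)\<close> passes through the
      homomorphism and cancels the \<open>(-1)^p\<close> found above; one minus sign
      remains.\<close>
    have "theta (2 * ?N + 1) (vcls (2 * ?N + 1) (frag_cmul ((- 1) ^ p) ?C))
        = theta (2 * ?N + 1) (vcls (2 * ?N + 1) ?C) [^]\<^bsub>op_grp V_operad (2 * ?N + 1)\<^esub> ((- 1) ^ p :: int)"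
      using T.hom_int_pow[OF carr[OF C]] vcls_int_pow[OF C] by simp
    also have "\<dots> = vcls (2 * ?N + 1) (- mcomp (2 * p + 2) ?B (qtree y))"
      unfolding 2 using vcls_int_pow[OF keys_cmulI[OF D]] by (simp flip: power_add mult_2)
    also have "\<dots> = vcls (2 * ?N + 1) (- qfrag (\<rho> (Node x y)))"
      unfolding vcls_eq_veq
      using veq_diff[OF veq_refl mcomp_max_\<gamma>[OF \<rho>_keys[of x], of y], of 0]
      by (simp add: p_def q_def)
    finally show ?case by (simp add: p_def q_def)
  qed
  then show ?thesis by (simp add: Q_qtree)
qed


section \<open>Classes of interval modules\<close>

lemma interval_module_simps [simp]:
  "rdim (interval_module U) x = (if x \<in> U then 1 else 0)"
  "rmap (interval_module U) y x = (if x \<in> U \<and> y \<in> U then 1\<^sub>m 1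
     else 0\<^sub>m (if x \<in> U then 1 else 0) (if y \<in> U then 1 else 0))"
  by (simp_all add: interval_module_def)

lemma carrier_vec_0: "carrier_vec 0 = {0\<^sub>v 0}"
  by auto

text \<open>Arrows point downwards, so a minimal point of \<open>U\<close> carries a submodule; the
  quotient lives on the rest.\<close>

lemma short_exact_interval:
  assumes "y \<in> U" and min: "\<And>z. z \<in> U \<Longrightarrow> leq z y \<Longrightarrow> z = y"
  shows "short_exact X leq (interval_module {y}) (interval_module U)
    (interval_module (U - {y}) :: ('v, 'k::field) qrep)"
proof -
  \<comment> \<open>\<open>d\<close> is the dimension vector of \<open>interval_module U\<close>; it
    fixes the shape of the empty matrices used where the submodule or the quotient vanishes.\<close>
  define d :: "'v \<Rightarrow> nat" where "d x = (if x \<in> U then 1 else 0)" for x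
  define f :: "'v \<Rightarrow> 'k mat" where "f x = (if x = y then 1\<^sub>m 1 else 0\<^sub>m (d x) 0)" for x
  define g :: "'v \<Rightarrow> 'k mat" where "g x = (if x \<in> U - {y} then 1\<^sub>m 1 else 0\<^sub>m 0 (d x))" for x
  have "f \<in> module_hom X leq (interval_module {y}) (interval_module U)"
    unfolding module_hom_def f_def d_def
    using assms by (auto simp: hasse_arrow_def)
  moreover have "g \<in> module_hom X leq (interval_module U) (interval_module (U - {y}))"
    unfolding module_hom_def g_def d_def
    using assms by (auto simp: hasse_arrow_def)
  moreover have "inj_on (\<lambda>v. f x *\<^sub>v v) (carrier_vec (rdim (interval_module {y} :: ('v, 'k) qrep) x)) \<and>
        (\<lambda>v. f x *\<^sub>v v) ` carrier_vec (rdim (interval_module {y} :: ('v, 'k) qrep) x) = mat_kernel (g x) \<and>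
        (\<lambda>v. g x *\<^sub>v v) ` carrier_vec (rdim (interval_module U :: ('v, 'k) qrep) x) =
          carrier_vec (rdim (interval_module (U - {y}) :: ('v, 'k) qrep) x)" for x
  proof -
    \<comment> \<open>The three dimensions at \<open>x\<close> are 1, 1, 0 at \<open>y\<close>, then
      0, 1, 1 at the other points of \<open>U\<close>, and 0, 0, 0 outside.\<close>
    consider "x = y" | "x \<in> U" "x \<noteq> y" | "x \<notin> U" "x \<noteq> y" by blast
    then show ?thesis
    proof cases
      case 1
      moreover have "0\<^sub>m 0 1 *\<^sub>v 0\<^sub>v 1 = (0\<^sub>v 0 :: 'k vec)" by auto
      ultimately show ?thesis using \<open>y \<in> U\<close>
        by (auto simp: f_def g_def d_def mat_kernel_def carrier_vec_0 inj_on_def image_iff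
            intro!: bexI[of _ "0\<^sub>v 1"])
    next
      case 2
      moreover have "0\<^sub>m 1 0 *\<^sub>v 0\<^sub>v 0 = (0\<^sub>v 1 :: 'k vec)" by (auto simp: scalar_prod_def)
      ultimately show ?thesis
        by (auto simp: f_def g_def d_def mat_kernel_def carrier_vec_0 inj_on_def image_iff)
    next
      case 3
      then show ?thesis
        by (auto simp: f_def g_def d_def mat_kernel_def carrier_vec_0 inj_on_def image_iff)
    qed
  qed
  ultimately show ?thesis unfolding short_exact_def by blast
qed

section \<open>Cosets of the Grothendieck relations\<close>

lemma K0_relations_subgroup:
  "subgroup (K0_relations X leq) (free_Abelian_group (poset_modules X leq))"
  unfolding K0_relations_def
proof (intro group.generate_is_subgroup group_free_Abelian_group subsetI)
  fix a
  assume "a \<in> {frag_of M - frag_of L - frag_of N | L M N.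
          L \<in> poset_modules X leq \<and> M \<in> poset_modules X leq \<and> N \<in> poset_modules X leq \<and>
          short_exact X leq L M N}"
  then obtain L M N where "a = frag_of M - frag_of L - frag_of N"
    "L \<in> poset_modules X leq" "M \<in> poset_modules X leq" "N \<in> poset_modules X leq" by blast
  then show "a \<in> carrier (free_Abelian_group (poset_modules X leq))"
    unfolding carrier_free_Abelian_group_iff by (simp only:) (intro keys_diffI; simp)
qed

lemma K0_relations_normal: "K0_relations X leq \<lhd> free_Abelian_group (poset_modules X leq)"
  by (rule comm_group.subgroup_imp_normal[OF abelian_free_Abelian_group K0_relations_subgroup])

lemma comm_group_K0: "comm_group (K0 X leq)"
  unfolding K0_def
  by (rule comm_group.abelian_FactGroup[OF abelian_free_Abelian_group K0_relations_subgroup])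

definition K0_coset ::
  "'v set \<Rightarrow> ('v \<Rightarrow> 'v \<Rightarrow> bool) \<Rightarrow> (('v, 'k::field) qrep \<Rightarrow>\<^sub>0 int) \<Rightarrow> (('v, 'k) qrep \<Rightarrow>\<^sub>0 int) set" where
  "K0_coset X leq a = K0_relations X leq #>\<^bsub>free_Abelian_group (poset_modules X leq)\<^esub> a"

lemma K0_class_coset: "K0_class X leq M = K0_coset X leq (frag_of M)"
  by (simp add: K0_class_def K0_coset_def)

lemma K0_coset_hom: "K0_coset X leq \<in> hom (free_Abelian_group (poset_modules X leq)) (K0 X leq)"
  using normal.r_coset_hom_Mod[OF K0_relations_normal[of X leq]] by (simp add: K0_coset_def[abs_def] K0_def)

lemma K0_coset_eqI:
  assumes "a - b \<in> K0_relations X leq"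
  shows "K0_coset X leq a = K0_coset X leq b"
proof -
  let ?R = "K0_relations X leq" and ?F = "free_Abelian_group (poset_modules X leq)"
  interpret subgroup ?R ?F by (rule K0_relations_subgroup)
  have neg: "b - a \<in> ?R" using m_inv_closed[OF assms] mem_carrier[OF assms] by simp
  have "h + a \<in> ?R #>\<^bsub>?F\<^esub> b" if "h \<in> ?R" for h
    using m_closed[OF that assms] by (auto simp: r_coset_def intro!: bexI[of _ "h + (a - b)"])
  moreover have "h + b \<in> ?R #>\<^bsub>?F\<^esub> a" if "h \<in> ?R" for h
    using m_closed[OF that neg] by (auto simp: r_coset_def intro!: bexI[of _ "h + (b - a)"])
  ultimately show ?thesis unfolding K0_coset_def by (auto simp: r_coset_def)
qed

text \<open>
  Peeling off a minimal element splits an interval module into a simple submodule and a smaller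
  interval module; \<open>\<mu>\<close> only serves to find minimal elements.
\<close>

lemma K0_coset_interval:
  fixes \<mu> :: "'v \<Rightarrow> nat"
  assumes refl: "\<And>x. leq x x" and trans: "\<And>x y z. leq x y \<Longrightarrow> leq y z \<Longrightarrow> leq x z"
    and \<mu>: "\<And>x y. leq x y \<Longrightarrow> x \<noteq> y \<Longrightarrow> \<mu> x < \<mu> y"
    and "finite U" "U \<noteq> {}" "\<And>x y z. x \<in> U \<Longrightarrow> z \<in> U \<Longrightarrow> y \<in> X \<Longrightarrow> leq x y \<Longrightarrow> leq y z \<Longrightarrow> y \<in> U"
  shows "frag_of (interval_module U) - (\<Sum>y\<in>U. frag_of (interval_module {y})) \<in>
    (K0_relations X leq :: (('v, 'k::field) qrep \<Rightarrow>\<^sub>0 int) set)"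
  using assms(4-)
proof (induction "card U" arbitrary: U rule: less_induct)
  case less
  let ?R = "K0_relations X leq :: (('v, 'k) qrep \<Rightarrow>\<^sub>0 int) set"
  interpret subgroup ?R "free_Abelian_group (poset_modules X leq)" by (rule K0_relations_subgroup)
  from less.prems(2) obtain x where "x \<in> U" by blast
  \<comment> \<open>A point of least \<open>\<mu>\<close> is minimal for \<open>leq\<close>.\<close>
  then obtain y where y: "y \<in> U" "\<forall>z. z \<in> U \<longrightarrow> \<mu> y \<le> \<mu> z"
    using ex_has_least_nat[of "\<lambda>y. y \<in> U" x \<mu>] by metis
  have min: "z = y" if "z \<in> U" "leq z y" for z
  proof (rule ccontr)
    assume "z \<noteq> y"
    from \<mu>[OF that(2) this] y(2) that(1) show False using leD by blast
  qed
  show ?case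
  proof (cases "U = {y}")
    case True
    then show ?thesis using one_closed by simp
  next
    case False
    \<comment> \<open>Removing a minimal point keeps \<open>U\<close> convex: \<open>w = y\<close>
      would force \<open>x\<close> below \<open>y\<close>, hence \<open>x = y\<close>.\<close>
    have convex: "w \<in> U - {y}" if "x \<in> U - {y}" "z \<in> U - {y}" "w \<in> X" "leq x w" "leq w z" for x w z
      using less.prems(3)[of x z w] min[of x] that(1,2,3,4,5) by blast
    have IH: "frag_of (interval_module (U - {y})) - (\<Sum>y\<in>U - {y}. frag_of (interval_module {y})) \<in> ?R"
    proof (rule less.hyps)
      show "card (U - {y}) < card U" using less.prems(1) y(1) by (rule card_Diff1_less)
      show "finite (U - {y})" "U - {y} \<noteq> {}" using less.prems(1) y(1) False by auto
    qed (rule convex)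
    have mod: "interval_module V \<in> poset_modules X leq"
      if "\<And>x y z. x \<in> V \<Longrightarrow> z \<in> V \<Longrightarrow> y \<in> X \<Longrightarrow> leq x y \<Longrightarrow> leq y z \<Longrightarrow> y \<in> V" for V
      using that refl trans by (rule interval_module_in)
    \<comment> \<open>Antisymmetry follows from \<open>\<mu>\<close> and makes singletons
      convex.\<close>
    have "w = y" if "leq y w" "leq w y" for w using \<mu>[OF that(1)] \<mu>[OF that(2)] by fastforce
    then have m1: "interval_module {y} \<in> poset_modules X leq" by (intro mod) auto
    have m2: "interval_module U \<in> poset_modules X leq" by (rule mod[OF less.prems(3)])
    have m3: "interval_module (U - {y}) \<in> poset_modules X leq" by (rule mod[OF convex])
    have exact: "short_exact X leq (interval_module {y}) (interval_module U)
        (interval_module (U - {y}) :: ('v, 'k) qrep)"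
      by (rule short_exact_interval[OF y(1) min])
    have "frag_of (interval_module U) - frag_of (interval_module {y}) - frag_of (interval_module (U - {y})) \<in> ?R"
      unfolding K0_relations_def
      by (rule generate.incl) (use m1 m2 m3 exact in blast)
    from m_closed[OF this IH] show ?thesis
      using less.prems(1) y(1) by (simp add: sum.remove algebra_simps)
  qed
qed


section \<open>Comparison of the two operators\<close>

text \<open>A potential that every rotation lowers strictly; it yields antisymmetry and serves as
  the rank \<open>\<mu>\<close> for peeling off minimal trees.\<close>

fun right_weight :: "pbt \<Rightarrow> nat" where
  "right_weight Leaf = 0"
| "right_weight (Node l r) = vertices r + right_weight l + right_weight r"

lemma rotation_right_weight: "rotation x y \<Longrightarrow> right_weight y < right_weight x"
  by (induction rule: rotation.induct) (auto dest: rotation_vertices)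

lemma tamari_right_weight: "tamari_le x y \<Longrightarrow> x \<noteq> y \<Longrightarrow> right_weight x < right_weight y"
proof (induction rule: tamari_induct)
  case (step u v)
  then show ?case using rotation_right_weight[OF step(1)] by (cases "u = y") auto
qed simp

text \<open>The one-point interval module at \<open>x\<close> is the simple module
  \<open>S_x\<close>.\<close>

definition simple_sum :: "(pbt \<Rightarrow>\<^sub>0 int) \<Rightarrow> ((pbt, 'k::field) qrep \<Rightarrow>\<^sub>0 int)" where
  "simple_sum = frag_extend (\<lambda>x. frag_of (interval_module {x}))"

lemma tamari_antisym: "tamari_le x y \<Longrightarrow> tamari_le y x \<Longrightarrow> x = y"
  using tamari_right_weight[of x y] tamari_right_weight[of y x] by fastforce

lemma simple_sum_hom:
  "simple_sum \<in> hom (free_Abelian_group (Y n))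
     (free_Abelian_group (poset_modules (Y n) tamari_le :: (pbt, 'k::field) qrep set))"
proof -
  have "interval_module {x} \<in> poset_modules (Y n) tamari_le" for x
    by (rule interval_module_in[OF _ tamari_le_refl tamari_le_trans]) (auto intro: tamari_antisym)
  then have "Poly_Mapping.keys (simple_sum f :: (pbt, 'k) qrep \<Rightarrow>\<^sub>0 int) \<subseteq> poset_modules (Y n) tamari_le" for f
    unfolding simple_sum_def by (intro order.trans[OF keys_frag_extend]) auto
  then show ?thesis
    by (auto simp: hom_def simple_sum_def frag_extend_add)
qed

lemma interval_class:
  assumes "U \<subseteq> Y n" "U \<noteq> {}"
    "\<And>x y z. x \<in> U \<Longrightarrow> z \<in> U \<Longrightarrow> y \<in> Y n \<Longrightarrow> tamari_le x y \<Longrightarrow> tamari_le y z \<Longrightarrow> y \<in> U"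
  shows "K0_class (Y n) tamari_le (interval_module U :: (pbt, 'k::field) qrep) =
    K0_coset (Y n) tamari_le (simple_sum (fsum U))"
proof -
  have fin: "finite U" using assms(1) finite_Y by (rule finite_subset)
  show ?thesis
    unfolding K0_class_coset simple_sum_def frag_extend_fsum[OF fin]
    by (rule K0_coset_eqI, rule K0_coset_interval[where \<mu> = right_weight])
       (fact tamari_le_refl tamari_le_trans tamari_right_weight fin assms(2,3))+
qed

section \<open>Projective and injective classes as sums of simples\<close>

lemma P_cls_simple:
  assumes "x \<in> Y n"
  shows "(P_cls n x :: 'k::field tamari_K0) = K0_coset (Y n) tamari_le (simple_sum (zeta (frag_of x)))"
proof -
  have sub: "{y. tamari_le y x} \<subseteq> Y n" using down_Y[of x] assms by (simp add: Y_def)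
  then have "{y \<in> Y n. tamari_le y x} = {y. tamari_le y x}" by blast
  moreover have "K0_class (Y n) tamari_le (interval_module {y. tamari_le y x} :: (pbt, 'k) qrep) =
      K0_coset (Y n) tamari_le (simple_sum (fsum {y. tamari_le y x}))"
  proof (rule interval_class[OF sub])
    show "{y. tamari_le y x} \<noteq> {}" using tamari_le_refl by blast
    show "b \<in> {y. tamari_le y x}" if "a \<in> {y. tamari_le y x}" "c \<in> {y. tamari_le y x}" "tamari_le a b" "tamari_le b c" for a b c
      using that tamari_le_trans[of b c x] by simp
  qed
  ultimately show ?thesis by (simp add: proj_module_def)
qed

lemma I_cls_simple:
  assumes "x \<in> Y n"
  shows "(I_cls n x :: 'k::field tamari_K0) = K0_coset (Y n) tamari_le (simple_sum (up x))"
proof -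
  have sub: "{y. tamari_le x y} \<subseteq> Y n" using up_Y[of x] assms by (simp add: Y_def)
  then have "{y \<in> Y n. tamari_le x y} = {y. tamari_le x y}" by blast
  moreover have "K0_class (Y n) tamari_le (interval_module {y. tamari_le x y} :: (pbt, 'k) qrep) =
      K0_coset (Y n) tamari_le (simple_sum (fsum {y. tamari_le x y}))"
  proof (rule interval_class[OF sub])
    show "{y. tamari_le x y} \<noteq> {}" using tamari_le_refl by blast
    show "b \<in> {y. tamari_le x y}" if "a \<in> {y. tamari_le x y}" "c \<in> {y. tamari_le x y}" "tamari_le a b" "tamari_le b c" for a b c
      using that tamari_le_trans[of x a b] by simp
  qed
  ultimately show ?thesis by (simp add: inj_module_def)
qed

section \<open>Homomorphisms out of the free group on trees\<close>

lemma hom_free_ext: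
  assumes "comm_group G" and h: "h \<in> hom (free_Abelian_group S) G" "h' \<in> hom (free_Abelian_group S) G"
    and eq: "\<And>x. x \<in> S \<Longrightarrow> h (frag_of x) = h' (frag_of x)"
    and f: "Poly_Mapping.keys f \<subseteq> S"
  shows "h f = h' f"
proof -
  interpret G: comm_group G by fact
  have gh: "group_hom (free_Abelian_group S) G k" if "k \<in> hom (free_Abelian_group S) G" for k
    using that by (intro group_hom.intro group_hom_axioms.intro) auto
  interpret h: group_hom "free_Abelian_group S" G h by (rule gh) fact
  interpret h': group_hom "free_Abelian_group S" G h' by (rule gh) fact
  have diff: "k (a - b) = k a \<otimes>\<^bsub>G\<^esub> inv\<^bsub>G\<^esub> k b"
    if "k \<in> hom (free_Abelian_group S) G" "Poly_Mapping.keys a \<subseteq> S" "Poly_Mapping.keys b \<subseteq> S" for k a b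
  proof -
    interpret k: group_hom "free_Abelian_group S" G k by (rule gh) fact
    show ?thesis using that k.hom_mult[of a "- b"] k.hom_inv[of b] by simp
  qed
  show ?thesis
    by (rule free_Abelian_group_induct[OF f])
       (use diff[OF h(1)] diff[OF h(2)] h.hom_one h'.hom_one eq in auto)
qed

lemma zeta_hom: "zeta \<in> hom (free_Abelian_group (Y n)) (free_Abelian_group (Y n))"
proof -
  have "Poly_Mapping.keys (zeta f) \<subseteq> Y n" if "Poly_Mapping.keys f \<subseteq> Y n" for f
    unfolding zeta_def
  proof (rule order.trans[OF keys_frag_extend], rule UN_least)
    fix x assume "x \<in> Poly_Mapping.keys f"
    then have "{z. tamari_le z x} \<subseteq> Y n" using that down_Y[of x] by (auto simp: Y_def)
    then show "Poly_Mapping.keys (fsum {z. tamari_le z x}) \<subseteq> Y n"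
      unfolding fsum_def by (intro order.trans[OF keys_sum]) auto
  qed
  then show ?thesis by (auto simp: hom_def zeta_def frag_extend_add)
qed

lemma qfrag_hom: "(\<lambda>f. vcls (2 * n + 1) (qfrag f)) \<in> hom (free_Abelian_group (Y n)) (op_grp V_operad (2 * n + 1))"
proof -
  have "vcls (2 * n + 1) (qfrag (f + g)) = vcls (2 * n + 1) (qfrag f) \<otimes>\<^bsub>op_grp V_operad (2 * n + 1)\<^esub> vcls (2 * n + 1) (qfrag g)"
    if "Poly_Mapping.keys f \<subseteq> Y n" "Poly_Mapping.keys g \<subseteq> Y n" for f g
    using vcls_add[OF vin_qfrag[OF that(1)] vin_qfrag[OF that(2)]] by (simp add: qfrag_def frag_extend_add)
  moreover have "vcls (2 * n + 1) (qfrag f) \<in> carrier (op_grp V_operad (2 * n + 1))"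
    if "Poly_Mapping.keys f \<subseteq> Y n" for f
    using vin_qfrag[OF that] by (simp add: carrier_V)
  ultimately show ?thesis by (simp add: hom_def)
qed

theorem mainTheorem1:
  fixes n :: nat
    and theta_V :: "nat \<Rightarrow> velem \<Rightarrow> velem"
    and \<psi> :: "velem \<Rightarrow> 'k::field tamari_K0"
    and cox :: "'k tamari_K0 \<Rightarrow> 'k tamari_K0"
  assumes "anticyclic_operad V_operad theta_V"
    and "theta_V 3 V_gen = inv\<^bsub>op_grp V_operad 3\<^esub> V_gen"
    and "\<psi> \<in> iso (op_grp V_operad (2 * n + 1)) (K0_Y n)"
    and "\<And>x. x \<in> Y n \<Longrightarrow> \<psi> (Q x) = P_cls n x"
    and "cox \<in> hom (K0_Y n) (K0_Y n)"
    and "\<And>x. x \<in> Y n \<Longrightarrow> cox (P_cls n x) = inv\<^bsub>K0_Y n\<^esub> I_cls n x"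
  shows "\<forall>v \<in> carrier (op_grp V_operad (2 * n + 1)).
           \<psi> (theta_V (2 * n + 1) v) = cox (\<psi> v)"
proof -
  interpret anticyclic_operad V_operad theta_V by fact
  let ?F = "free_Abelian_group (Y n)" and ?V = "op_grp V_operad (2 * n + 1)"
    and ?K = "K0_Y n :: 'k tamari_K0 monoid"
  \<comment> \<open>Both operators are compared on the free group of trees: \<open>q\<close> sends
    \<open>x\<close> to \<open>Q x\<close>, and \<open>\<sigma>\<close> sends it to the class of
    \<open>S_x\<close>.\<close>
  define q where "q f = vcls (2 * n + 1) (qfrag f)" for f
  define \<sigma> :: "(pbt \<Rightarrow>\<^sub>0 int) \<Rightarrow> 'k tamari_K0" where "\<sigma> f = K0_coset (Y n) tamari_le (simple_sum f)" for f
  have \<psi>: "\<psi> \<in> hom ?V ?K" using assms(3) by (simp add: iso_def)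
  have q: "q \<in> hom ?F ?V" using qfrag_hom[of n] by (simp add: q_def[abs_def])
  have \<theta>: "theta_V (2 * n + 1) \<in> hom ?V ?V" by (rule theta_hom) simp
  have \<sigma>: "\<sigma> \<in> hom ?F ?K"
    using hom_compose[OF simple_sum_hom K0_coset_hom] by (simp add: \<sigma>_def[abs_def] comp_def)
  have hom_minus: "k (- a) = inv\<^bsub>?K\<^esub> k a" if "k \<in> hom ?F ?K" "Poly_Mapping.keys a \<subseteq> Y n" for k a
  proof -
    interpret K: comm_group ?K by (rule comm_group_K0)
    interpret k: group_hom ?F ?K k
      using that by (intro group_hom.intro group_hom_axioms.intro K.is_group) auto
    show ?thesis using k.hom_inv[of a] that by simp
  qed
  have Q: "Q x = q (frag_of x)" if "x \<in> Y n" for x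
    using that by (simp add: Q_qtree q_def Y_def)
  \<comment> \<open>On a single tree \<open>\<psi>\<close> gives the projective class, and
    \<open>zeta\<close> is its expansion into simples.\<close>
  have \<psi>q: "\<psi> (q f) = \<sigma> (zeta f)" if "Poly_Mapping.keys f \<subseteq> Y n" for f
  proof -
    have "(\<psi> \<circ> q) f = (\<sigma> \<circ> zeta) f"
    proof (rule hom_free_ext[OF comm_group_K0 hom_compose[OF q \<psi>] hom_compose[OF zeta_hom \<sigma>] _ that])
      fix x assume x: "x \<in> Y n"
      show "(\<psi> \<circ> q) (frag_of x) = (\<sigma> \<circ> zeta) (frag_of x)"
        using assms(4)[OF x] unfolding Q[OF x] P_cls_simple[OF x] \<sigma>_def by simp
    qed
    then show ?thesis by simp
  qed
  have main: "\<psi> (theta_V (2 * n + 1) (q f)) = cox (\<psi> (q f))" if "Poly_Mapping.keys f \<subseteq> Y n" for f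
  proof -
    have "(\<psi> \<circ> (theta_V (2 * n + 1) \<circ> q)) f = (cox \<circ> (\<psi> \<circ> q)) f"
    proof (rule hom_free_ext[OF comm_group_K0 hom_compose[OF hom_compose[OF q \<theta>] \<psi>]
          hom_compose[OF hom_compose[OF q \<psi>] assms(5)] _ that])
      fix x assume x: "x \<in> Y n"
      then have [simp]: "vertices x = n" by (simp add: Y_def)
      have \<rho>: "Poly_Mapping.keys (\<rho> x) \<subseteq> Y n" using \<rho>_keys[of x] by simp
      have up: "Poly_Mapping.keys (up x) \<subseteq> Y n"
        using hom_in_carrier[OF zeta_hom, of "\<rho> x" n] \<rho> by (simp add: zeta_\<rho>)
      \<comment> \<open>Theta gives \<open>- \<rho> x\<close>, and \<open>zeta\<close> turns
        \<open>\<rho> x\<close> into the up-set of \<open>x\<close>, the composition factors of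
        \<open>I_x\<close>.\<close>
      have "\<psi> (theta_V (2 * n + 1) (q (frag_of x))) = \<psi> (q (- \<rho> x))"
        using theta_V_Q[OF assms(1,2), of x] unfolding Q[OF x] q_def by simp
      also have "\<dots> = \<sigma> (- up x)"
        using \<psi>q[of "- \<rho> x"] \<rho> zeta_simps(2)[of 0 "\<rho> x"] by (simp add: zeta_\<rho>)
      also have "\<dots> = inv\<^bsub>?K\<^esub> I_cls n x"
        using hom_minus[OF \<sigma> up] unfolding I_cls_simple[OF x] \<sigma>_def .
      also have "\<dots> = cox (\<psi> (q (frag_of x)))"
        using assms(4,6)[OF x] unfolding Q[OF x] by simp
      finally show "(\<psi> \<circ> (theta_V (2 * n + 1) \<circ> q)) (frag_of x) = (cox \<circ> (\<psi> \<circ> q)) (frag_of x)"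
        by simp
    qed
    then show ?thesis by simp
  qed
  show ?thesis
  proof
    \<comment> \<open>The \<open>Q_x\<close> span, so equality on their combinations
      suffices.\<close>
    fix v assume "v \<in> carrier ?V"
    then obtain f where "Poly_Mapping.keys f \<subseteq> Y n" "v = q f" unfolding q_def by (rule V_spanned)
    then show "\<psi> (theta_V (2 * n + 1) v) = cox (\<psi> v)" using main by simp
  qed
qed

end
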